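(* Let $A\subset\mathbb{R}$ be a finite set with $|A|\ge 2$ and let $K\ge 1$ be a real number. Suppose that $|A/A|\le K|A|$. Then $$|A+A| \gtrsim \max\left\{|A|^{\frac{19}{12}}K^{-\frac{5}{6}},\ |A|^{\frac{1313}{830}}K^{-\frac{336}{415}}\right\}.$$
   Context: $A+A=\{a+b: a,b\in A\}$, $A/A=\{a/b : a,b\in A,\ b\ne 0\}$. Notation: $X \gtrsim Y$ means $Y = O(X\cdot \log^{C}|A|)$ for some absolute constant $C>0$, with an absolute implied constant. *)

theory Defs
  imports "HOL-Analysis.Analysis" "HOL-Library.Set_Algebras"
begin

text \<open>The sumset \<open>A + A\<close> is the pointwise sum of sets from \<open>Set_Algebras\<close>, which provides no
  division of sets.\<close>

definition ratio_set :: "'a::field set \<Rightarrow> 'a set" where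
  "ratio_set A = {a / b | a b. a \<in> A \<and> b \<in> A \<and> b \<noteq> 0}"

end

theory Submission
  imports Defs "HOL-Library.Discrete_Functions"
begin

text \<open>
  For \<open>A\<close> positive, write \<open>N = |A|\<close>, \<open>Q = A/A\<close>, \<open>A\<^sub>l = {x \<in> A. l x \<in> A}\<close>.  Both terms are dominated by the
  stronger bound \<open>|A + A| \<ge> c N^(19/12) K^(-4/5) / log N\<close>.

  Following Solymosi and Konyagin-Shkredov, view \<open>A\<^sub>l\<close> as points of \<open>A \<times> A\<close> on the line of slope \<open>l\<close>
  through the origin and group the popular lines into clusters of \<open>M\<close> consecutive slopes.  Sums of
  points taken from two lines of one cluster stay in the sector of that cluster, so different clusters
  give different elements of \<open>(A + A) \<times> (A + A)\<close>.  Inside a cluster, a coincidence between the sums of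
  two pairs of lines forces \<open>\<alpha> x + \<beta> y = z\<close> with \<open>x\<close>, \<open>y\<close>, \<open>z\<close> in sets \<open>A\<^sub>l\<close>, and \<open>M\<close> can be taken as
  large as the bound on the number of such solutions permits.

  If every \<open>x\<close> has many factorisations \<open>x = u v\<close> with \<open>u \<in> U\<close> and \<open>v \<in> V\<close>, these solutions become
  incidences between a Cartesian product and lines.  When \<open>|Q \<inter> Q/l|\<close> is small for most pairs
  \<open>(a, b)\<close> with \<open>a/b = l\<close>, take \<open>x = (x/a) a\<close>, where \<open>x/a \<in> Q \<inter> Q/l\<close> lies in a small set.  Otherwise
  pass to the \<open>a \<in> A\<close> for which \<open>l = a/b\<close>, with \<open>b\<close> fixed, has \<open>|Q \<inter> Q/l|\<close> large: then
  \<open>a = (b l r) (1/r)\<close> for all \<open>r \<in> Q \<inter> Q/l\<close>.  The two cases balance at \<open>|Q \<inter> Q/l| = K^(4/5) N\<close>.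
\<close>

section \<open>Incidences with Cartesian products\<close>

definition rank :: "'a::linorder set \<Rightarrow> 'a \<Rightarrow> nat" where
  "rank X x = card {y \<in> X. y < x}"

lemma rank_mono: "finite X \<Longrightarrow> x \<le> y \<Longrightarrow> rank X x \<le> rank X y"
  unfolding rank_def by (rule card_mono) auto

lemma rank_strict_mono: "finite X \<Longrightarrow> x \<in> X \<Longrightarrow> x < y \<Longrightarrow> rank X x < rank X y"
  unfolding rank_def by (rule psubset_card_mono) auto

lemma bij_betw_rank:
  assumes "finite X"
  shows "bij_betw (rank X) X {..<card X}"
proof -
  have inj: "inj_on (rank X) X"
    by (rule inj_onI) (metis assms linorder_neqE nat_less_le rank_strict_mono)
  have "rank X ` X \<subseteq> {..<card X}"
    unfolding rank_def using assms by (auto intro!: psubset_card_mono)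
  then have "rank X ` X = {..<card X}"
    by (intro card_subset_eq) (simp_all add: card_image[OF inj])
  then show ?thesis using inj by (simp add: bij_betw_def)
qed

text \<open>The set lies between its least and greatest elements, whose distance times
  \<open>r\<close> is at most \<open>n\<close>; the hypothesis \<open>r \<le> n\<close> absorbs the
  extra endpoint of that interval.\<close>

lemma card_le_of_diff_bound:
  fixes J :: "nat set"
  assumes "finite J" "r \<le> n" "\<And>k k'. k \<in> J \<Longrightarrow> k' \<in> J \<Longrightarrow> k * r \<le> k' * r + n"
  shows "card J * r \<le> 2 * n"
proof (cases "J = {}")
  case False
  have "J \<subseteq> {Min J..Max J}" using assms(1) by auto
  then have "card J \<le> card {Min J..Max J}" by (intro card_mono) auto
  also have "\<dots> = Max J + 1 - Min J" by simp
  finally have "card J * r \<le> (Max J + 1 - Min J) * r" by (rule mult_right_mono) simp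
  also have "\<dots> = Max J * r + r - Min J * r" by (simp add: algebra_simps diff_mult_distrib)
  also have "\<dots> \<le> 2 * n"
    using assms(2) assms(3)[of "Max J" "Min J"] Max_in[OF assms(1) False] Min_in[OF assms(1) False]
    by linarith
  finally show ?thesis .
qed simp

text \<open>The increasing enumeration of \<open>X\<close> is cut into \<open>r\<close> consecutive
  blocks. Ranks with the same quotient differ by at most \<open>card X / r\<close>, so a block has
  at most \<open>2 * card X / r\<close> elements; summing over \<open>X\<close> bounds the pairs
  that share a block.\<close>

lemma ex_mono_block_function:
  fixes X :: "'a::linorder set"
  assumes "finite X" "0 < r" "r \<le> card X"
  obtains f :: "'a \<Rightarrow> nat" where "mono f" "\<forall>x\<in>X. f x < r"
    "card {(x, x'). x \<in> X \<and> x' \<in> X \<and> f x = f x'} * r \<le> 2 * (card X)\<^sup>2"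
proof -
  define n where "n = card X"
  define f where "f x = rank X x * r div n" for x
  have n: "0 < n" "r \<le> n" using assms by (auto simp: n_def)
  have bij: "bij_betw (rank X) X {..<n}" using bij_betw_rank[OF assms(1)] by (simp add: n_def)
  have "mono f"
    unfolding f_def by (intro monoI div_le_mono mult_right_mono rank_mono assms) auto
  moreover have "f x < r" if "x \<in> X" for x
  proof -
    have "rank X x < n" using bij that by (auto simp: bij_betw_def)
    then show ?thesis unfolding f_def using assms(2)
      by (simp add: less_mult_imp_div_less mult.commute)
  qed
  moreover have "card {(x, x'). x \<in> X \<and> x' \<in> X \<and> f x = f x'} * r \<le> 2 * n\<^sup>2"
  proof -
    have fib: "card {x' \<in> X. f x = f x'} * r \<le> 2 * n" for x
    proof -
      let ?S = "{x' \<in> X. f x = f x'}"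
      have "card (rank X ` ?S) * r \<le> 2 * n"
      proof (rule card_le_of_diff_bound)
        fix k k' assume "k \<in> rank X ` ?S" "k' \<in> rank X ` ?S"
        then have eq: "k * r div n = k' * r div n" by (auto simp: f_def)
        have "k * r = (k * r div n) * n + k * r mod n" by simp
        also have "\<dots> \<le> (k' * r div n) * n + n" using eq n by (simp add: less_imp_le)
        also have "\<dots> \<le> k' * r + n" by simp
        finally show "k * r \<le> k' * r + n" .
      qed (use assms n in auto)
      moreover have "card (rank X ` ?S) = card ?S"
        by (rule card_image) (use bij in \<open>auto simp: bij_betw_def inj_on_def\<close>)
      ultimately show ?thesis by simp
    qed
    have "{(x, x'). x \<in> X \<and> x' \<in> X \<and> f x = f x'} = Sigma X (\<lambda>x. {x' \<in> X. f x = f x'})" by auto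
    then have "card {(x, x'). x \<in> X \<and> x' \<in> X \<and> f x = f x'} * r
        = (\<Sum>x\<in>X. card {x' \<in> X. f x = f x'} * r)"
      using assms(1) by (simp add: card_SigmaI sum_distrib_right)
    also have "\<dots> \<le> (\<Sum>x\<in>X. 2 * n)" by (intro sum_mono fib)
    also have "\<dots> = 2 * n\<^sup>2" by (simp add: n_def power2_eq_square)
    finally show ?thesis .
  qed
  ultimately show ?thesis using that by (simp add: n_def)
qed

text \<open>Fix one representative in each fibre of \<open>c\<close>. There are at most as many
  representatives as values, and every other element collides with the representative of its
  fibre.\<close>

lemma card_le_image_plus_collisions:
  assumes "finite K"
  shows "card K \<le> card (c ` K) + card {(x, x'). x \<in> K \<and> x' \<in> K \<and> x \<noteq> x' \<and> c x = c x'}"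
    (is "_ \<le> _ + card ?P")
proof -
  define s where "s = inv_into K c"
  have s: "s (c x) \<in> K" "c (s (c x)) = c x" if "x \<in> K" for x
    using that by (auto simp: s_def inv_into_into f_inv_into_f)
  have finP: "finite ?P" by (rule finite_subset[of _ "K \<times> K"]) (use assms in auto)
  have "K \<subseteq> s ` c ` K \<union> {x \<in> K. s (c x) \<noteq> x}" by force
  then have "card K \<le> card (s ` c ` K \<union> {x \<in> K. s (c x) \<noteq> x})"
    by (intro card_mono) (use assms in auto)
  also have "\<dots> \<le> card (s ` c ` K) + card {x \<in> K. s (c x) \<noteq> x}" by (rule card_Un_le)
  also have "card (s ` c ` K) \<le> card (c ` K)" using assms by (intro card_image_le) auto
  also have "card {x \<in> K. s (c x) \<noteq> x} \<le> card ?P"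
    by (rule card_inj_on_le[where f = "\<lambda>x. (x, s (c x))"]) (use s finP in \<open>auto simp: inj_on_def\<close>)
  finally show ?thesis by simp
qed

text \<open>On an increasing staircase the sum of the coordinates is injective, on a decreasing one
  their difference, shifted by \<open>r\<close> to stay a natural number. Either takes at most
  \<open>2 * r\<close> values.\<close>

lemma card_monotone_chain_le:
  fixes P :: "(nat \<times> nat) set"
  assumes "P \<subseteq> {..<r} \<times> {..<r}"
    and "(\<forall>p\<in>P. \<forall>q\<in>P. fst p < fst q \<longrightarrow> snd p \<le> snd q) \<or>
         (\<forall>p\<in>P. \<forall>q\<in>P. fst p < fst q \<longrightarrow> snd q \<le> snd p)"
  shows "card P \<le> 2 * r"
  using assms(2)
proof
  assume *: "\<forall>p\<in>P. \<forall>q\<in>P. fst p < fst q \<longrightarrow> snd p \<le> snd q"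
  have "inj_on (\<lambda>p. fst p + snd p) P"
  proof (rule inj_onI)
    fix p q assume "p \<in> P" "q \<in> P" "fst p + snd p = fst q + snd q"
    then show "p = q" using * by (intro prod_eqI; cases "fst p" "fst q" rule: linorder_cases) force+
  qed
  then have "card P \<le> card {..<2 * r}"
    by (rule card_inj_on_le) (use assms(1) in force)+
  then show ?thesis by simp
next
  assume *: "\<forall>p\<in>P. \<forall>q\<in>P. fst p < fst q \<longrightarrow> snd q \<le> snd p"
  have "inj_on (\<lambda>p. fst p + (r - snd p)) P"
  proof (rule inj_onI)
    fix p q assume pq: "p \<in> P" "q \<in> P" "fst p + (r - snd p) = fst q + (r - snd q)"
    have "snd p < r" "snd q < r" using pq assms(1) by auto
    moreover have "fst p < fst q \<longrightarrow> snd q \<le> snd p" "fst q < fst p \<longrightarrow> snd p \<le> snd q"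
      using * pq by auto
    ultimately have "fst p = fst q" using pq(3) by linarith
    then show "p = q" using pq(3) \<open>snd p < r\<close> \<open>snd q < r\<close> by (intro prod_eqI) auto
  qed
  then have "card P \<le> card {1..<2 * r + 1}"
  proof (rule card_inj_on_le)
    show "(\<lambda>p. fst p + (r - snd p)) ` P \<subseteq> {1..<2 * r + 1}"
    proof (rule image_subsetI)
      fix p assume "p \<in> P"
      then have "fst p < r" "snd p < r" using assms(1) by auto
      then show "fst p + (r - snd p) \<in> {1..<2 * r + 1}" by auto
    qed
  qed simp
  then show ?thesis by simp
qed

text \<open>A line \<open>(m, b)\<close> stands for \<open>y = m x + b\<close>.  Splitting a Cartesian product into an
  \<open>r\<close> by \<open>r\<close> grid replaces the planar cell decompositions behind the Szemeredi-Trotter theorem: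
  a line meets at most \<open>2 r\<close> cells, and two points of a cell lie on at most one line.\<close>

definition incidences :: "real set \<Rightarrow> real set \<Rightarrow> (real \<times> real) set \<Rightarrow> ((real \<times> real) \<times> real) set" where
  "incidences X Y L = Sigma L (\<lambda>l. {x \<in> X. fst l * x + snd l \<in> Y})"

text \<open>The points on a line are counted as one per cell met, plus the pairs of points sharing a
  cell. The cells cost \<open>2 * r\<close> per line; the pairs are bounded for all lines together
  by the product of the block-pair counts of \<open>X\<close> and \<open>Y\<close>.\<close>

lemma incidences_grid_bound:
  assumes fin: "finite X" "finite Y" "finite L"
    and r: "0 < r" "r \<le> card X" "r \<le> card Y"
  shows "real (card (incidences X Y L))
    \<le> 2 * real r * real (card L) + 4 * (real (card X) * real (card Y))\<^sup>2 / (real r)\<^sup>2"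
proof -
  obtain f :: "real \<Rightarrow> nat" where f: "mono f" "\<forall>x\<in>X. f x < r"
    "card {(x, x'). x \<in> X \<and> x' \<in> X \<and> f x = f x'} * r \<le> 2 * (card X)\<^sup>2"
    using ex_mono_block_function[OF fin(1) r(1,2)] by blast
  obtain g :: "real \<Rightarrow> nat" where g: "mono g" "\<forall>y\<in>Y. g y < r"
    "card {(y, y'). y \<in> Y \<and> y' \<in> Y \<and> g y = g y'} * r \<le> 2 * (card Y)\<^sup>2"
    using ex_mono_block_function[OF fin(2) r(1,3)] by blast
  let ?EX = "{(x, x'). x \<in> X \<and> x' \<in> X \<and> f x = f x'}"
  let ?EY = "{(y, y'). y \<in> Y \<and> y' \<in> Y \<and> g y = g y'}"
  have finE: "finite ?EX" "finite ?EY"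
    by (rule finite_subset[of _ "X \<times> X"], use fin in auto)
       (rule finite_subset[of _ "Y \<times> Y"], use fin in auto)
  define h where "h l x = fst l * x + snd l" for l :: "real \<times> real" and x
  define c where "c l x = (f x, g (h l x))" for l x
  define K where "K l = {x \<in> X. h l x \<in> Y}" for l
  define D where "D l = {(x, x'). x \<in> K l \<and> x' \<in> K l \<and> x \<noteq> x' \<and> c l x = c l x'}" for l
  have finK: "finite (K l)" for l using fin by (simp add: K_def)
  have finD: "finite (D l)" for l
    by (rule finite_subset[of _ "K l \<times> K l"]) (use finK in \<open>auto simp: D_def\<close>)
  have "card (K l) \<le> 2 * r + card (D l)" if l: "l \<in> L" for l
  proof -
    have "card (c l ` K l) \<le> 2 * r"
    proof (rule card_monotone_chain_le)
      show "c l ` K l \<subseteq> {..<r} \<times> {..<r}" using f(2) g(2) by (auto simp: c_def K_def)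
      have less: "x < x'" if "f x < f x'" for x x' using f(1) that by (meson leD leI monoD)
      show "(\<forall>p\<in>c l ` K l. \<forall>q\<in>c l ` K l. fst p < fst q \<longrightarrow> snd p \<le> snd q) \<or>
         (\<forall>p\<in>c l ` K l. \<forall>q\<in>c l ` K l. fst p < fst q \<longrightarrow> snd q \<le> snd p)"
      \<comment> \<open>The sign of the slope decides whether the cells met form an increasing or a
        decreasing staircase; horizontal lines fall under the second case.\<close>
      proof (cases "0 < fst l")
        case True
        then show ?thesis
          by (intro disjI1) (auto simp: c_def h_def intro!: monoD[OF g(1)] mult_left_mono dest!: less)
      next
        case False
        then show ?thesis
          by (intro disjI2)
            (auto simp: c_def h_def intro!: monoD[OF g(1)] mult_left_mono_neg dest!: less)
      qed
    qed
    then show ?thesis using card_le_image_plus_collisions[OF finK, of l "c l"] by (simp add: D_def)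
  qed
  then have "(\<Sum>l\<in>L. card (K l)) \<le> (\<Sum>l\<in>L. 2 * r + card (D l))" by (rule sum_mono)
  also have "\<dots> = 2 * r * card L + card (Sigma L D)"
    using fin(3) finD by (simp add: sum.distrib card_SigmaI)
  \<comment> \<open>Two points with different abscissae determine the line through them, so a
    colliding pair is charged to one line only.\<close>
  also have "card (Sigma L D) \<le> card (?EX \<times> ?EY)"
  proof (rule card_inj_on_le[where f = "\<lambda>(l, x, x'). ((x, x'), (h l x, h l x'))"])
    show "inj_on (\<lambda>(l, x, x'). ((x, x'), (h l x, h l x'))) (Sigma L D)"
    proof (rule inj_onI, clarsimp simp: D_def)
      fix m b m' b' x x'
      assume "x \<noteq> x'" and e: "h (m, b) x = h (m', b') x" "h (m, b) x' = h (m', b') x'"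
      then have "(m - m') * (x - x') = 0" by (simp add: h_def algebra_simps)
      then have "m = m'" using \<open>x \<noteq> x'\<close> by simp
      then show "m = m' \<and> b = b'" using e by (simp add: h_def)
    qed
    show "(\<lambda>(l, x, x'). ((x, x'), (h l x, h l x'))) ` Sigma L D \<subseteq> ?EX \<times> ?EY"
      by (auto simp: D_def K_def c_def)
  qed (use finE in simp)
  finally have 1: "(\<Sum>l\<in>L. card (K l)) \<le> 2 * r * card L + card ?EX * card ?EY"
    by (simp add: card_cartesian_product)
  have "real (card ?EX) \<le> 2 * (real (card X))\<^sup>2 / real r"
    using f(3) r(1) by (simp add: pos_le_divide_eq flip: of_nat_mult of_nat_power)
  moreover have "real (card ?EY) \<le> 2 * (real (card Y))\<^sup>2 / real r"
    using g(3) r(1) by (simp add: pos_le_divide_eq flip: of_nat_mult of_nat_power)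
  ultimately have "real (card ?EX) * real (card ?EY)
      \<le> (2 * (real (card X))\<^sup>2 / real r) * (2 * (real (card Y))\<^sup>2 / real r)"
    by (intro mult_mono) auto
  also have "\<dots> = 4 * (real (card X) * real (card Y))\<^sup>2 / (real r)\<^sup>2"
    by (simp add: power2_eq_square)
  finally have 2: "real (card ?EX) * real (card ?EY)
      \<le> 4 * (real (card X) * real (card Y))\<^sup>2 / (real r)\<^sup>2" .
  have "card (incidences X Y L) = (\<Sum>l\<in>L. card (K l))"
    using fin by (simp add: incidences_def K_def h_def card_SigmaI)
  then have "real (card (incidences X Y L)) \<le> real (2 * r * card L + card ?EX * card ?EY)"
    using 1 by (simp only: of_nat_le_iff)
  then show ?thesis using 2 by simp
qed

section \<open>A Szemeredi-Trotter bound from the grid bound and the trivial bounds\<close>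

lemma incidences_trivial_bounds:
  assumes fin: "finite X" "finite Y" "finite L"
    and slope: "\<And>l. l \<in> L \<Longrightarrow> fst l \<noteq> 0"
  shows "card (incidences X Y L) \<le> card X * card L" "card (incidences X Y L) \<le> card Y * card L"
proof -
  have c: "card (incidences X Y L) = (\<Sum>l\<in>L. card {x \<in> X. fst l * x + snd l \<in> Y})"
    using fin by (simp add: incidences_def card_SigmaI)
  also have "\<dots> \<le> (\<Sum>l\<in>L. card X)" by (intro sum_mono card_mono fin) auto
  finally show "card (incidences X Y L) \<le> card X * card L" by (simp add: mult.commute)
  have "card {x \<in> X. fst l * x + snd l \<in> Y} \<le> card Y" if "l \<in> L" for l
    by (rule card_inj_on_le[where f = "\<lambda>x. fst l * x + snd l"])
       (use fin slope[OF that] in \<open>auto simp: inj_on_def\<close>)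
  then have "(\<Sum>l\<in>L. card {x \<in> X. fst l * x + snd l \<in> Y}) \<le> (\<Sum>l\<in>L. card Y)"
    by (rule sum_mono)
  then show "card (incidences X Y L) \<le> card Y * card L" using c by (simp add: mult.commute)
qed

theorem szemeredi_trotter_cartesian:
  assumes fin: "finite X" "finite Y" "finite L"
    and slope: "\<And>l. l \<in> L \<Longrightarrow> fst l \<noteq> 0"
  shows "real (card (incidences X Y L))
    \<le> 18 * (real (card X) * real (card Y) * real (card L)) powr (2/3) + 6 * real (card L)"
proof (cases "card X = 0 \<or> card Y = 0 \<or> card L = 0")
  case True
  then have "card (incidences X Y L) = 0"
    using incidences_trivial_bounds[OF assms] by auto
  then show ?thesis by simp
next
  case False
  define x y l p I where "x = real (card X)" and "y = real (card Y)" and "l = real (card L)"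
    and "p = x * y" and "I = real (card (incidences X Y L))"
  have pos: "1 \<le> x" "1 \<le> y" "1 \<le> l" using False by (auto simp: x_def y_def l_def Suc_le_eq)
  then have p: "1 \<le> p" unfolding p_def using mult_mono[of 1 x 1 y] by simp
  have tr: "I \<le> x * l" "I \<le> y * l"
    using incidences_trivial_bounds[OF assms] unfolding I_def x_def y_def l_def
    by (metis of_nat_le_iff of_nat_mult)+
  \<comment> \<open>The grid size at which the two terms \<open>r * l\<close> and
    \<open>p^2 / r^2\<close> of the grid bound balance; their common value is
    \<open>T\<close>.\<close>
  define s where "s = (p\<^sup>2 / l) powr (1/3)"
  have s0: "0 < s" using p pos by (simp add: s_def)
  have s3: "s ^ 3 = p\<^sup>2 / l" using p pos by (simp add: s_def powr_powr flip: powr_numeral)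
  define T where "T = (p * l) powr (2/3)"
  have T0: "0 < T" using p pos by (simp add: T_def)
  have T3: "T ^ 3 = (p * l)\<^sup>2" using p pos by (simp add: T_def powr_powr flip: powr_numeral)
  have sT: "s * l = T"
  proof (rule power_eq_imp_eq_base[of _ 3])
    have "(s * l) ^ 3 = p\<^sup>2 / l * l ^ 3" by (simp only: power_mult_distrib s3)
    also have "\<dots> = T ^ 3" unfolding T3 using pos by (simp add: power3_eq_cube power2_eq_square)
    finally show "(s * l) ^ 3 = T ^ 3" .
  qed (use s0 pos T0 in auto)
  have small: "z * l \<le> T" if "0 \<le> z" "z \<le> s" for z
    using that sT pos mult_right_mono[of z s l] by simp
  \<comment> \<open>For \<open>s < 1\<close> a single cell suffices, since then
    \<open>p^2 < l\<close>. For \<open>x \<le> s\<close> or \<open>y \<le> s\<close> a trivial bound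
    is at most \<open>s * l = T\<close>. Otherwise \<open>s\<close> is rounded down to a grid size,
    losing at most a factor 2, which gives \<open>18 = 2 + 16\<close>.\<close>
  consider "s < 1" | "x \<le> s" | "y \<le> s" | "1 \<le> s" "s < x" "s < y" by linarith
  then have "I \<le> 18 * T + 6 * l"
  proof cases
    case 1
    then have "s ^ 3 < 1" using s0 by (simp add: power_less_one_iff)
    then have "p\<^sup>2 < l" using s3 pos by simp
    moreover have "I \<le> 2 * l + 4 * p\<^sup>2"
      using incidences_grid_bound[OF fin, of 1] pos unfolding I_def l_def x_def y_def p_def by simp
    ultimately show ?thesis using T0 by linarith
  next
    case 2 then show ?thesis using small[of x] tr pos T0 by linarith
  next
    case 3 then show ?thesis using small[of y] tr pos T0 by linarith
  next
    case 4
    define r where "r = nat \<lfloor>s\<rfloor>"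
    have "1 \<le> \<lfloor>s\<rfloor>" using 4 by simp
    then have r: "1 \<le> r" "real r \<le> s" "s \<le> 2 * real r" unfolding r_def by linarith+
    have rr: "r \<le> card X" "r \<le> card Y" using r 4 unfolding x_def y_def by linarith+
    have "I \<le> 2 * real r * l + 4 * p\<^sup>2 / (real r)\<^sup>2"
      using incidences_grid_bound[OF fin, of r] r rr unfolding I_def l_def x_def y_def p_def by simp
    also have "2 * real r * l \<le> 2 * T" using small[of "real r"] r by simp
    also have "4 * p\<^sup>2 / (real r)\<^sup>2 \<le> 16 * (p\<^sup>2 / s\<^sup>2)"
    proof -
      have "s\<^sup>2 \<le> (2 * real r)\<^sup>2" using r s0 by (intro power_mono) auto
      then have "4 * p\<^sup>2 * s\<^sup>2 \<le> 4 * p\<^sup>2 * (4 * (real r)\<^sup>2)" by (intro mult_left_mono) (auto simp: power_mult_distrib)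
      then show ?thesis using s0 r by (simp add: field_simps)
    qed
    also have "p\<^sup>2 / s\<^sup>2 = T"
    proof -
      have "p\<^sup>2 = s ^ 3 * l" using s3 pos by simp
      then show ?thesis using sT s0 by (simp add: power3_eq_cube power2_eq_square)
    qed
    finally show ?thesis using pos by simp
  qed
  then show ?thesis by (simp add: I_def T_def p_def x_def y_def l_def)
qed

text \<open>A factorisation \<open>x = u * v\<close> turns a solution into an incidence of the point
  \<open>(u, \<alpha> * x + \<beta> * y)\<close> with the line of slope \<open>\<alpha> * v\<close>
  and intercept \<open>\<beta> * y\<close>. Each solution thus yields at least \<open>\<rho>\<close>
  incidences between the product of \<open>U\<close> and \<open>B3\<close> and a family of
  \<open>card V * card B2\<close> lines.\<close>

lemma card_linear_relation_bound:
  fixes B1 B2 B3 U V :: "real set"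
  assumes fin: "finite B1" "finite B2" "finite B3" "finite U" "finite V"
    and nz: "0 \<notin> V" "\<alpha> \<noteq> 0" "\<beta> \<noteq> 0"
    and rep: "\<And>x. x \<in> B1 \<Longrightarrow> \<rho> \<le> real (card {(u, v). u \<in> U \<and> v \<in> V \<and> u * v = x})"
  shows "\<rho> * real (card {(x, y). x \<in> B1 \<and> y \<in> B2 \<and> \<alpha> * x + \<beta> * y \<in> B3})
    \<le> 18 * (real (card U) * real (card B3) * (real (card V) * real (card B2))) powr (2/3)
      + 6 * (real (card V) * real (card B2))"
proof -
  define R where "R x = {(u, v). u \<in> U \<and> v \<in> V \<and> u * v = x}" for x
  define T where "T = {(x, y). x \<in> B1 \<and> y \<in> B2 \<and> \<alpha> * x + \<beta> * y \<in> B3}"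
  define L where "L = (\<lambda>(v, y). (\<alpha> * v, \<beta> * y)) ` (V \<times> B2)"
  have finR: "finite (R x)" for x
    by (rule finite_subset[of _ "U \<times> V"]) (use fin in \<open>auto simp: R_def\<close>)
  have finT: "finite T"
    by (rule finite_subset[of _ "B1 \<times> B2"]) (use fin in \<open>auto simp: T_def\<close>)
  have cL: "card L = card V * card B2"
    unfolding L_def using nz by (subst card_image) (auto simp: inj_on_def card_cartesian_product)
  have finL: "finite L" using fin by (simp add: L_def)
  have finI: "finite (incidences U B3 L)" using finL fin by (auto simp: incidences_def)
  have "\<rho> * real (card T) = (\<Sum>t\<in>T. \<rho>)" by simp
  also have "\<dots> \<le> (\<Sum>t\<in>T. real (card (R (fst t))))"
    using rep by (intro sum_mono) (auto simp: T_def R_def)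
  also have "\<dots> = real (card (Sigma T (\<lambda>t. R (fst t))))"
    using finT finR by (simp add: card_SigmaI)
  also have "card (Sigma T (\<lambda>t. R (fst t))) \<le> card (incidences U B3 L)"
    by (rule card_inj_on_le[where f = "\<lambda>((x, y), (u, v)). ((\<alpha> * v, \<beta> * y), u)"])
       (use nz finI in \<open>auto simp: inj_on_def T_def R_def incidences_def L_def ac_simps\<close>)
  also have "real (card (incidences U B3 L))
      \<le> 18 * (real (card U) * real (card B3) * real (card L)) powr (2/3) + 6 * real (card L)"
    by (rule szemeredi_trotter_cartesian) (use nz fin finL in \<open>auto simp: L_def\<close>)
  finally show ?thesis by (simp add: T_def cL)
qed

section \<open>Sums of points on lines through the origin\<close>

text \<open>A weak Bonferroni inequality: every overlap is subtracted in both orders.\<close>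

lemma sum_card_le_card_Union_plus_overlaps:
  assumes "finite I" "\<And>i. i \<in> I \<Longrightarrow> finite (U i)"
  shows "(\<Sum>i\<in>I. card (U i)) \<le> card (\<Union>i\<in>I. U i) + (\<Sum>i\<in>I. \<Sum>j\<in>I - {i}. card (U i \<inter> U j))"
  using assms
proof (induction I rule: finite_induct)
  case (insert k I)
  let ?W = "\<Union>i\<in>I. U i"
  have finW: "finite ?W" using insert by auto
  have "card (U k) + card ?W = card (U k \<union> ?W) + card (U k \<inter> ?W)"
    using insert finW by (intro card_Un_Int) auto
  moreover have "card (U k \<inter> ?W) \<le> (\<Sum>j\<in>I. card (U k \<inter> U j))"
    unfolding Int_UN_distrib using insert.hyps by (intro card_UN_le)
  moreover have "(\<Sum>i\<in>I. \<Sum>j\<in>I - {i}. card (U i \<inter> U j))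
      \<le> (\<Sum>i\<in>I. \<Sum>j\<in>insert k I - {i}. card (U i \<inter> U j))"
    using insert.hyps by (intro sum_mono sum_mono2) auto
  moreover have "insert k I - {k} = I" using insert.hyps by auto
  moreover have "(\<Sum>i\<in>I. card (U i)) \<le> card ?W + (\<Sum>i\<in>I. \<Sum>j\<in>I - {i}. card (U i \<inter> U j))"
    using insert by auto
  ultimately show ?case using insert.hyps by simp
qed simp

text \<open>An element \<open>x\<close> of \<open>F l\<close> stands for the point
  \<open>(x, l * x)\<close> on the line of slope \<open>l\<close>. These are the vector sums of
  points from the two lines whose slopes form \<open>p\<close>.\<close>

definition line_sums :: "(real \<Rightarrow> real set) \<Rightarrow> real \<times> real \<Rightarrow> (real \<times> real) set" where
  "line_sums F p = (\<lambda>(x, y). (x + y, fst p * x + snd p * y)) ` (F (fst p) \<times> F (snd p))"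

lemma inj_line_sum:
  fixes l m :: real
  assumes "l \<noteq> m"
  shows "inj (\<lambda>(x, y). (x + y, l * x + m * y))"
proof (rule injI, clarsimp)
  fix x y x' y' :: real
  assume e: "x + y = x' + y'" "l * x + m * y = l * x' + m * y'"
  have "(l - m) * (x - x') = (l * x + m * y - (l * x' + m * y')) - m * (x + y - (x' + y'))"
    by (simp add: algebra_simps)
  then have "(l - m) * (x - x') = 0" using e by simp
  then show "x = x' \<and> y = y'" using assms e by simp
qed

lemma card_line_sums:
  assumes "fst p \<noteq> snd p"
  shows "card (line_sums F p) = card (F (fst p)) * card (F (snd p))"
  unfolding line_sums_def
  by (subst card_image) (auto intro: inj_on_subset[OF inj_line_sum[OF assms]] simp: card_cartesian_product)

text \<open>Some slope \<open>l\<close> of \<open>q\<close> does not occur in \<open>p\<close>. The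
  linear form vanishing on the line of slope \<open>l\<close>, applied to a common sum, eliminates
  the point on that line and leaves \<open>z = \<alpha> * x + \<beta> * y\<close> with nonzero
  coefficients. As \<open>(x, y)\<close> determines the sum, the number of solutions bounds the
  intersection.\<close>

lemma card_line_sums_Int_le:
  assumes p: "fst p \<in> C" "snd p \<in> C" "fst p < snd p" and q: "fst q \<in> C" "snd q \<in> C" "fst q < snd q"
    and ne: "p \<noteq> q" and fin: "\<And>l. l \<in> C \<Longrightarrow> finite (F l)"
    and T: "\<And>l1 l2 l3 \<alpha> \<beta>. l1 \<in> C \<Longrightarrow> l2 \<in> C \<Longrightarrow> l3 \<in> C \<Longrightarrow> \<alpha> \<noteq> 0 \<Longrightarrow> \<beta> \<noteq> 0 \<Longrightarrow>
      real (card {(x, y). x \<in> F l1 \<and> y \<in> F l2 \<and> \<alpha> * x + \<beta> * y \<in> F l3}) \<le> T"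
  shows "real (card (line_sums F p \<inter> line_sums F q)) \<le> T"
proof -
  obtain i j where ij: "p = (i, j)" by (cases p)
  \<comment> \<open>Distinct increasing pairs cannot have the same two entries. Here
    \<open>l\<close> is an entry of \<open>q\<close> missing from \<open>p\<close>, while the other
    entry \<open>k\<close> may occur in \<open>p\<close>.\<close>
  obtain k l where kl: "{k, l} = {fst q, snd q}" "k \<noteq> l" "l \<noteq> i" "l \<noteq> j"
  proof (cases "snd q \<in> {i, j}")
    case True
    then have "fst q \<noteq> i" "fst q \<noteq> j" using p q ne ij by (auto simp: prod_eq_iff)
    then show ?thesis using that[of "snd q" "fst q"] q by auto
  next
    case False
    then show ?thesis using that[of "fst q" "snd q"] q by auto
  qed
  define \<alpha> \<beta> where "\<alpha> = (i - l) / (k - l)" and "\<beta> = (j - l) / (k - l)"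
  let ?T = "{(x, y). x \<in> F i \<and> y \<in> F j \<and> \<alpha> * x + \<beta> * y \<in> F k}"
  have kC: "k \<in> C" using kl q by (metis insertI1 insert_iff singletonD)
  have finT: "finite ?T" by (rule finite_subset[of _ "F i \<times> F j"]) (use fin p ij in auto)
  have "line_sums F p \<inter> line_sums F q \<subseteq> (\<lambda>(x, y). (x + y, i * x + j * y)) ` ?T"
  proof
    fix w assume w: "w \<in> line_sums F p \<inter> line_sums F q"
    then obtain x y where xy: "x \<in> F i" "y \<in> F j" "w = (x + y, i * x + j * y)"
      by (auto simp: line_sums_def ij)
    have "\<exists>z z'. z \<in> F k \<and> z' \<in> F l \<and> w = (z + z', k * z + l * z')"
    proof (cases "k = fst q")
      case True
      then have "l = snd q" using kl by (auto simp: doubleton_eq_iff)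
      then show ?thesis using w True by (auto simp: line_sums_def)
    next
      case False
      then have "k = snd q" "l = fst q" using kl by (auto simp: doubleton_eq_iff)
      then show ?thesis using w by (auto simp: line_sums_def)
    qed
    then obtain z z' where z: "z \<in> F k" "x + y = z + z'" "i * x + j * y = k * z + l * z'"
      using xy by auto
    have "(k - l) * z = (k * z + l * z') - l * (z + z')" by (simp add: algebra_simps)
    also have "\<dots> = (i - l) * x + (j - l) * y" unfolding z(2,3)[symmetric] by (simp add: algebra_simps)
    finally have "z = ((i - l) * x + (j - l) * y) / (k - l)" using kl(2) by (simp add: eq_divide_eq mult.commute)
    then have "z = \<alpha> * x + \<beta> * y" unfolding \<alpha>_def \<beta>_def by (simp add: add_divide_distrib)
    then show "w \<in> (\<lambda>(x, y). (x + y, i * x + j * y)) ` ?T" using xy z(1)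
      by (intro image_eqI[where x = "(x, y)"]) auto
  qed
  then have "card (line_sums F p \<inter> line_sums F q) \<le> card ((\<lambda>(x, y). (x + y, i * x + j * y)) ` ?T)"
    by (intro card_mono finite_imageI finT)
  also have "\<dots> \<le> card ?T" by (rule card_image_le[OF finT])
  also have "real (card ?T) \<le> T"
    by (rule T) (use p ij kC kl in \<open>auto simp: \<alpha>_def \<beta>_def\<close>)
  finally show ?thesis by simp
qed

lemma card_ordered_pairs:
  fixes C :: "'a::linorder set"
  assumes "finite C"
  shows "2 * card {p \<in> C \<times> C. fst p < snd p} + card C = (card C)\<^sup>2"
proof -
  let ?P = "{p \<in> C \<times> C. fst p < snd p}"
  let ?D = "(\<lambda>x. (x, x)) ` C"
  have f: "finite ?P" "finite (prod.swap ` ?P)" "finite ?D" using assms by auto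
  have "C \<times> C = ?P \<union> (prod.swap ` ?P \<union> ?D)" by force
  then have "card (C \<times> C) = card (?P \<union> (prod.swap ` ?P \<union> ?D))" by simp
  also have "\<dots> = card ?P + card (prod.swap ` ?P \<union> ?D)" using f by (intro card_Un_disjoint) auto
  also have "card (prod.swap ` ?P \<union> ?D) = card (prod.swap ` ?P) + card ?D"
    using f by (intro card_Un_disjoint) auto
  also have "card (prod.swap ` ?P) = card ?P" by (intro card_image) (auto simp: inj_on_def)
  also have "card ?D = card C" by (intro card_image) (auto simp: inj_on_def)
  finally show ?thesis by (simp add: card_cartesian_product power2_eq_square)
qed

text \<open>The \<open>m\<close> pairs of lines give \<open>\<Delta>^2\<close> sums each, and the
  overlaps amount to at most \<open>m * (m - 1) * T\<close>. Since
  \<open>2 * (m - 1) \<le> M^2\<close>, the condition on \<open>M\<close> keeps this below half of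
  the main term; for \<open>M = 2\<close> there is one pair and no overlap. With
  \<open>M^2 \<le> 4 * m\<close> the constant becomes 1/8.\<close>

lemma card_cluster_sums:
  fixes C :: "real set" and \<Delta> M :: nat
  assumes C: "finite C" "card C = M" "2 \<le> M"
    and F: "\<And>l. l \<in> C \<Longrightarrow> finite (F l)" "\<And>l. l \<in> C \<Longrightarrow> card (F l) = \<Delta>"
    and T: "\<And>l1 l2 l3 \<alpha> \<beta>. l1 \<in> C \<Longrightarrow> l2 \<in> C \<Longrightarrow> l3 \<in> C \<Longrightarrow> \<alpha> \<noteq> 0 \<Longrightarrow> \<beta> \<noteq> 0 \<Longrightarrow>
      real (card {(x, y). x \<in> F l1 \<and> y \<in> F l2 \<and> \<alpha> * x + \<beta> * y \<in> F l3}) \<le> T"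
    and M: "M = 2 \<or> (real M)\<^sup>2 * T \<le> (real \<Delta>)\<^sup>2"
  shows "(real M)\<^sup>2 * (real \<Delta>)\<^sup>2 / 8 \<le> real (card (\<Union>p\<in>{p \<in> C \<times> C. fst p < snd p}. line_sums F p))"
proof -
  define P where "P = {p \<in> C \<times> C. fst p < snd p}"
  define m where "m = card P"
  have finP: "finite P" using C by (simp add: P_def)
  have finL: "finite (line_sums F p)" if "p \<in> P" for p
    using that F by (auto simp: line_sums_def P_def)
  have m: "2 * m + M = M\<^sup>2" using card_ordered_pairs[OF C(1)] C by (simp add: m_def P_def)
  have "2 * M \<le> M\<^sup>2" using C by (simp add: power2_eq_square)
  then have m4: "M\<^sup>2 \<le> 4 * m" and m1: "1 \<le> m" using m C by linarith+
  have T0: "0 \<le> T"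
  proof -
    obtain l where "l \<in> C" using C by fastforce
    from T[OF this this this, of 1 1] show ?thesis by (simp add: order_trans[rotated])
  qed
  have "(\<Sum>p\<in>P. card (line_sums F p))
      \<le> card (\<Union>p\<in>P. line_sums F p) + (\<Sum>p\<in>P. \<Sum>q\<in>P - {p}. card (line_sums F p \<inter> line_sums F q))"
    by (rule sum_card_le_card_Union_plus_overlaps) (use finP finL in auto)
  moreover have "(\<Sum>p\<in>P. card (line_sums F p)) = m * \<Delta>\<^sup>2"
  proof -
    have "(\<Sum>p\<in>P. card (line_sums F p)) = (\<Sum>p\<in>P. \<Delta>\<^sup>2)"
      by (intro sum.cong) (auto simp: P_def card_line_sums F power2_eq_square)
    then show ?thesis by (simp add: m_def)
  qed
  ultimately have "real (m * \<Delta>\<^sup>2) \<le> real (card (\<Union>p\<in>P. line_sums F p)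
      + (\<Sum>p\<in>P. \<Sum>q\<in>P - {p}. card (line_sums F p \<inter> line_sums F q)))"
    by (simp only: of_nat_le_iff)
  also have "\<dots> = real (card (\<Union>p\<in>P. line_sums F p))
      + (\<Sum>p\<in>P. \<Sum>q\<in>P - {p}. real (card (line_sums F p \<inter> line_sums F q)))" by simp
  also have "(\<Sum>p\<in>P. \<Sum>q\<in>P - {p}. real (card (line_sums F p \<inter> line_sums F q)))
      \<le> (\<Sum>p\<in>P. \<Sum>q\<in>P - {p}. T)"
    by (intro sum_mono card_line_sums_Int_le[where C = C] F T) (auto simp: P_def)
  also have "\<dots> = real m * ((real m - 1) * T)"
    using finP m1 by (simp add: m_def card_Diff_singleton of_nat_diff)
  also have "\<dots> \<le> real m * ((real \<Delta>)\<^sup>2 / 2)"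
  proof (intro mult_left_mono)
    from M show "(real m - 1) * T \<le> (real \<Delta>)\<^sup>2 / 2"
    proof
      assume "M = 2" then have "m = 1" using m by simp
      then show ?thesis by simp
    next
      assume a: "(real M)\<^sup>2 * T \<le> (real \<Delta>)\<^sup>2"
      have "2 * m \<le> M\<^sup>2" using m by linarith
      then have "real (2 * m) \<le> real (M\<^sup>2)" by (rule of_nat_mono)
      then have "2 * (real m - 1) \<le> (real M)\<^sup>2" by simp
      then have "2 * (real m - 1) * T \<le> (real M)\<^sup>2 * T" using T0 by (rule mult_right_mono)
      then show ?thesis using a by (simp add: algebra_simps)
    qed
  qed simp
  finally have "real m * (real \<Delta>)\<^sup>2 / 2 \<le> real (card (\<Union>p\<in>P. line_sums F p))" by simp
  moreover have "(real M)\<^sup>2 * (real \<Delta>)\<^sup>2 \<le> (4 * real m) * (real \<Delta>)\<^sup>2"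
  proof (rule mult_right_mono)
    have "real (M\<^sup>2) \<le> real (4 * m)" using m4 by (rule of_nat_mono)
    then show "(real M)\<^sup>2 \<le> 4 * real m" by simp
  qed simp
  ultimately show ?thesis by (simp add: P_def)
qed

text \<open>Slopes are grouped by rank into clusters of \<open>M\<close> consecutive ones. The sums
  from one cluster lie in the sector between its extreme slopes, and these sectors are disjoint, so
  the cluster bounds add up inside the Cartesian square of \<open>A + A\<close>.\<close>

lemma sumset_card_ge_clusters:
  fixes A \<Lambda> :: "real set" and F :: "real \<Rightarrow> real set" and \<Delta> M :: nat
  assumes A: "finite A" "\<And>a. a \<in> A \<Longrightarrow> 0 < a"
    and L: "finite \<Lambda>" "2 \<le> M" "M \<le> card \<Lambda>"
    and F: "\<And>l x. l \<in> \<Lambda> \<Longrightarrow> x \<in> F l \<Longrightarrow> x \<in> A \<and> l * x \<in> A" "\<And>l. l \<in> \<Lambda> \<Longrightarrow> card (F l) = \<Delta>"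
    and T: "\<And>l1 l2 l3 \<alpha> \<beta>. l1 \<in> \<Lambda> \<Longrightarrow> l2 \<in> \<Lambda> \<Longrightarrow> l3 \<in> \<Lambda> \<Longrightarrow> \<alpha> \<noteq> 0 \<Longrightarrow> \<beta> \<noteq> 0 \<Longrightarrow>
      real (card {(x, y). x \<in> F l1 \<and> y \<in> F l2 \<and> \<alpha> * x + \<beta> * y \<in> F l3}) \<le> T"
    and M: "M = 2 \<or> (real M)\<^sup>2 * T \<le> (real \<Delta>)\<^sup>2"
  shows "real (card \<Lambda>) * real M * (real \<Delta>)\<^sup>2 \<le> 16 * (real (card (A + A)))\<^sup>2"
proof -
  define n where "n = card \<Lambda>"
  define C where "C i = {l \<in> \<Lambda>. rank \<Lambda> l div M = i}" for i
  define W where "W i = (\<Union>p\<in>{p \<in> C i \<times> C i. fst p < snd p}. line_sums F p)" for i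
  have bij: "bij_betw (rank \<Lambda>) \<Lambda> {..<n}" using bij_betw_rank[OF L(1)] by (simp add: n_def)
  have finF: "finite (F l)" if "l \<in> \<Lambda>" for l
    by (rule finite_subset[OF _ A(1)]) (use F(1) that in auto)
  have cardC: "card (C i) = M" if "i < n div M" for i
  proof -
    have "rank \<Lambda> ` C i = {k \<in> {..<n}. k div M = i}"
      using bij unfolding bij_betw_def C_def by (auto simp: image_iff)
    also have "\<dots> = {i * M..<i * M + M}"
    proof -
      have "(i + 1) * M \<le> n"
        using that by (metis Suc_eq_plus1 Suc_leI div_times_less_eq_dividend le_trans mult_le_mono1)
      then have le: "i * M + M \<le> n" by simp
      have iff: "k div M = i \<longleftrightarrow> i * M \<le> k \<and> k < i * M + M" for k
        using L(2) div_nat_eqI[of M i k] by (auto simp: mult.commute dividend_less_times_div add.commute)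
      show ?thesis unfolding iff using le by force
    qed
    finally have "card (rank \<Lambda> ` C i) = M" by simp
    moreover have "inj_on (rank \<Lambda>) (C i)" using bij by (auto simp: bij_betw_def C_def inj_on_def)
    ultimately show ?thesis by (simp add: card_image)
  qed
  have sep: "l < m" if "l \<in> C i" "m \<in> C j" "i < j" for l m i j
  proof (rule ccontr)
    assume "\<not> l < m"
    then have "rank \<Lambda> m div M \<le> rank \<Lambda> l div M" using L(1) by (intro div_le_mono rank_mono) auto
    then show False using that by (simp add: C_def)
  qed
  have sub: "W i \<subseteq> (A + A) \<times> (A + A)" for i
    using F(1) by (auto simp: W_def line_sums_def C_def intro!: set_plus_intro)
  \<comment> \<open>Because all abscissae are positive, the slope of a sum lies between the slopes
    of its summands.\<close>
  have sector: "0 < fst w \<and> (\<exists>l\<in>C i. \<exists>m\<in>C i. l * fst w \<le> snd w \<and> snd w \<le> m * fst w)"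
    if w: "w \<in> W i" for i w
  proof -
    obtain l m x y where lm: "l \<in> C i" "m \<in> C i" "l < m" "x \<in> F l" "y \<in> F m"
        "w = (x + y, l * x + m * y)"
      using w by (force simp: W_def line_sums_def)
    then have "0 < x" "0 < y" using F(1) A(2) by (auto simp: C_def)
    moreover from this have "l * y \<le> m * y" "l * x \<le> m * x" using lm by (auto intro: mult_right_mono)
    ultimately have "0 < fst w" "l * fst w \<le> snd w" "snd w \<le> m * fst w"
      using lm(6) by (auto simp: algebra_simps)
    then show ?thesis using lm(1,2) by blast
  qed
  have noteq: "False" if ij: "i < j" and w: "w \<in> W i" "w \<in> W j" for i j w
  proof -
    obtain m where m: "m \<in> C i" "snd w \<le> m * fst w" "0 < fst w" using sector[OF w(1)] by auto
    obtain l where l: "l \<in> C j" "l * fst w \<le> snd w" using sector[OF w(2)] by auto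
    have "m * fst w < l * fst w" using sep[OF m(1) l(1) ij] m(3) by simp
    then show False using m(2) l(2) by linarith
  qed
  have disj: "W i \<inter> W j = {}" if "i \<noteq> j" for i j
    using that noteq by (metis disjoint_iff linorder_neqE_nat)
  have finS: "finite ((A + A) \<times> (A + A))" using A(1) by (intro finite_cartesian_product finite_set_plus)
  have finW: "finite (W i)" for i using finite_subset[OF sub finS] .
  have "(\<Sum>i<n div M. card (W i)) = card (\<Union>i<n div M. W i)"
    by (rule card_UN_disjoint[symmetric]) (use finW disj in auto)
  also have "\<dots> \<le> card ((A + A) \<times> (A + A))" by (rule card_mono[OF finS]) (use sub in auto)
  finally have "real (\<Sum>i<n div M. card (W i)) \<le> real (card ((A + A) \<times> (A + A)))" by (rule of_nat_mono)
  then have 1: "(\<Sum>i<n div M. real (card (W i))) \<le> (real (card (A + A)))\<^sup>2"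
    by (simp add: card_cartesian_product power2_eq_square)
  have "(\<Sum>i<n div M. (real M)\<^sup>2 * (real \<Delta>)\<^sup>2 / 8) \<le> (\<Sum>i<n div M. real (card (W i)))"
  proof (rule sum_mono)
    fix i assume "i \<in> {..<n div M}"
    then show "(real M)\<^sup>2 * (real \<Delta>)\<^sup>2 / 8 \<le> real (card (W i))"
      unfolding W_def
      by (intro card_cluster_sums[where T = T] cardC T M L finF F(2)) (use L(1) in \<open>auto simp: C_def\<close>)
  qed
  then have 2: "real (n div M) * real M * (real M * (real \<Delta>)\<^sup>2) / 8 \<le> (real (card (A + A)))\<^sup>2"
    using 1 by (simp add: power2_eq_square mult.assoc)
  \<comment> \<open>Only full clusters are used; as \<open>M \<le> n\<close>, they contain at least
    half of the slopes. This doubles the constant 8 to 16.\<close>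
  have "n \<le> 2 * (n div M * M)"
  proof -
    have "1 * M \<le> n div M * M" using L by (intro mult_right_mono) (auto simp: n_def Suc_le_eq div_greater_zero_iff)
    moreover have "n mod M < M" using L by simp
    moreover have "n = n div M * M + n mod M" by simp
    ultimately show ?thesis by linarith
  qed
  then have "real n \<le> real (2 * (n div M * M))" by (rule of_nat_mono)
  then have "real n * (real M * (real \<Delta>)\<^sup>2) \<le> real (2 * (n div M * M)) * (real M * (real \<Delta>)\<^sup>2)"
    by (rule mult_right_mono) simp
  then show ?thesis using 2 by (simp add: n_def mult.assoc)
qed

section \<open>Choice of the cluster size\<close>

text \<open>Here \<open>D\<close> is the number of points per line, \<open>T\<close> the bound on
  the number of solutions, and \<open>D / sqrt T\<close> the largest \<open>M\<close> with
  \<open>M^2 * T \<le> D^2\<close>. The first estimate rests on \<open>D \<ge> x / (16 * K)\<close>,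
  the second on \<open>D \<le> x\<close>.\<close>

lemma cluster_size_bounds:
  fixes x K D :: real
  assumes x: "1 \<le> x" and K: "1 \<le> K" and D: "0 < D" "D \<le> x" "x \<le> 16 * K * D"
  defines "T \<equiv> 24 * K powr (8/15) * x powr (1/3) * D powr (4/3)"
  shows "x powr (7/6) * K powr (- (8/5)) \<le> 1280 * (D\<^sup>2 / sqrt T)" "D / sqrt T \<le> x powr (1/6)"
proof -
  have pos: "0 < x" "0 < K" using x K by auto
  have sq: "sqrt (a powr b) = a powr (b / 2)" if "0 < a" for a b :: real
    using that by (simp add: powr_half_sqrt[symmetric] powr_powr)
  have T: "sqrt T = sqrt 24 * K powr (4/15) * x powr (1/6) * D powr (2/3)"
    unfolding T_def using pos D by (simp add: real_sqrt_mult sq)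
  have s24: "1 \<le> sqrt 24" "sqrt 24 \<le> (5::real)"
    using real_le_lsqrt[of 5 24] by auto
  have T0: "0 < sqrt T" unfolding T using pos D by simp
  \<comment> \<open>After multiplication by \<open>sqrt T\<close> the powers of \<open>x\<close> and
    \<open>K\<close> combine to \<open>(x / K) powr (4/3)\<close>, to which
    \<open>x / K \<le> 16 * D\<close> applies. The constant is \<open>1280 = 5 * 16^2\<close>, where
    5 bounds \<open>sqrt 24\<close> and the exponent 4/3 of 16 is rounded up to 2.\<close>
  have "x powr (7/6) * K powr (- (8/5)) * sqrt T
      = sqrt 24 * ((x powr (7/6) * x powr (1/6)) * (K powr (- (8/5)) * K powr (4/15)) * D powr (2/3))"
    unfolding T by (simp add: mult_ac)
  also have "\<dots> = sqrt 24 * (x powr (4/3) * K powr (- (4/3)) * D powr (2/3))"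
    by (simp flip: powr_add)
  also have "\<dots> = sqrt 24 * ((x / K) powr (4/3) * D powr (2/3))"
    using pos by (simp add: powr_divide powr_minus_divide)
  also have "\<dots> \<le> 5 * ((16 * D) powr (4/3) * D powr (2/3))"
    using pos D s24 by (intro mult_mono powr_mono2) (auto simp: field_simps)
  also have "\<dots> = 5 * (16 powr (4/3) * (D powr (4/3) * D powr (2/3)))"
    using D by (simp add: powr_mult)
  also have "D powr (4/3) * D powr (2/3) = D\<^sup>2" using D by (simp flip: powr_add powr_numeral)
  also have "5 * (16 powr (4/3) * D\<^sup>2) \<le> 5 * (16 powr 2 * D\<^sup>2)"
    by (intro mult_left_mono mult_right_mono powr_mono) auto
  finally have "x powr (7/6) * K powr (- (8/5)) * sqrt T \<le> 1280 * D\<^sup>2" by simp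
  then show "x powr (7/6) * K powr (- (8/5)) \<le> 1280 * (D\<^sup>2 / sqrt T)"
    using T0 by (simp add: pos_le_divide_eq)
  have "D = D powr (1/3) * D powr (2/3)" using D by (simp flip: powr_add)
  also have "\<dots> \<le> x powr (1/3) * D powr (2/3)" using D pos by (intro mult_right_mono powr_mono2) auto
  also have "\<dots> = x powr (1/6) * (1 * 1 * x powr (1/6) * D powr (2/3))" by (simp flip: powr_add mult.assoc)
  also have "\<dots> \<le> x powr (1/6) * sqrt T"
    unfolding T using s24 K by (intro mult_left_mono mult_right_mono mult_mono ge_one_powr_ge_zero) auto
  finally show "D / sqrt T \<le> x powr (1/6)" using T0 by (simp add: pos_divide_le_eq)
qed

section \<open>Dyadic pigeonholing and the bound for a family of popular slopes\<close>

lemma card_le_sumset: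
  fixes A :: "real set"
  assumes "finite A"
  shows "card A \<le> card (A + A)"
proof (cases "A = {}")
  case False
  then obtain a where "a \<in> A" by auto
  then show ?thesis
    by (intro card_inj_on_le[where f = "(+) a"] finite_set_plus assms) (auto intro: set_plus_intro)
qed simp

text \<open>If every level carried less than its share of the total, summing over the
  \<open>floor_log N + 1\<close> levels would give less than the total.\<close>

lemma ex_dyadic_level:
  fixes w :: "'a \<Rightarrow> nat"
  assumes "finite I" "\<And>i. i \<in> I \<Longrightarrow> 1 \<le> w i \<and> w i \<le> N"
  obtains j where "(\<Sum>i\<in>I. w i) \<le> (floor_log N + 1) * (card {i \<in> I. floor_log (w i) = j} * 2 ^ (j + 1))"
proof (rule ccontr)
  let ?c = "\<lambda>j. card {i \<in> I. floor_log (w i) = j} * 2 ^ (j + 1)"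
  let ?J = "floor_log N"
  assume nt: "\<not> thesis"
  have less: "(?J + 1) * ?c j < (\<Sum>i\<in>I. w i)" for j
    by (rule not_le_imp_less) (use nt that[of j] in blast)
  have lev: "floor_log (w i) \<in> {..?J}" if "i \<in> I" for i
    using assms(2)[OF that] floor_log_le_iff by auto
  have "(\<Sum>i\<in>I. w i) = (\<Sum>j\<le>?J. \<Sum>i\<in>{i \<in> I. floor_log (w i) = j}. w i)"
    by (rule sum.group[symmetric]) (use assms(1) lev in auto)
  also have "\<dots> \<le> (\<Sum>j\<le>?J. ?c j)"
  proof (rule sum_mono)
    fix j
    have "w i \<le> 2 ^ (j + 1)" if "floor_log (w i) = j" for i
      using floor_log_exp2_ge[of "w i"] that by auto
    then have "(\<Sum>i\<in>{i \<in> I. floor_log (w i) = j}. w i) \<le> (\<Sum>i\<in>{i \<in> I. floor_log (w i) = j}. 2 ^ (j + 1))"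
      by (intro sum_mono) simp
    then show "(\<Sum>i\<in>{i \<in> I. floor_log (w i) = j}. w i) \<le> ?c j" by simp
  qed
  finally have "(?J + 1) * (\<Sum>i\<in>I. w i) \<le> (\<Sum>j\<le>?J. (?J + 1) * ?c j)"
    by (simp only: sum_distrib_left[symmetric] mult_le_mono2)
  also have "\<dots> < (\<Sum>j\<le>?J. \<Sum>i\<in>I. w i)" by (intro sum_strict_mono less) auto
  also have "\<dots> = (?J + 1) * (\<Sum>i\<in>I. w i)" by simp
  finally show False by simp
qed

text \<open>The common end of both cases of the main argument, which differ only in the choice of
  \<open>\<Lambda>\<close> and \<open>F\<close>. The bound on solutions is required for equally
  large subsets of the sets \<open>F l\<close>, because these are trimmed to a common size before
  clustering.\<close>

lemma sumset_bound_of_rich_slopes: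
  fixes A \<Lambda> :: "real set" and F :: "real \<Rightarrow> real set" and K :: real
  assumes A: "finite A" "A \<noteq> {}" "\<And>a. a \<in> A \<Longrightarrow> 0 < a" and K: "1 \<le> K"
    and L: "finite \<Lambda>" "real (card \<Lambda>) \<le> K * real (card A)"
    and F: "\<And>l x. l \<in> \<Lambda> \<Longrightarrow> x \<in> F l \<Longrightarrow> x \<in> A \<and> l * x \<in> A"
    and mass: "(real (card A))\<^sup>2 / 4 \<le> (\<Sum>l\<in>\<Lambda>. real (card (F l)))"
    and T: "\<And>l1 l2 l3 B1 B2 B3 \<alpha> \<beta> \<Delta>. l1 \<in> \<Lambda> \<Longrightarrow> l2 \<in> \<Lambda> \<Longrightarrow> l3 \<in> \<Lambda> \<Longrightarrow> \<alpha> \<noteq> 0 \<Longrightarrow> \<beta> \<noteq> 0 \<Longrightarrow>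
      B1 \<subseteq> F l1 \<Longrightarrow> B2 \<subseteq> F l2 \<Longrightarrow> B3 \<subseteq> F l3 \<Longrightarrow>
      card B1 = \<Delta> \<Longrightarrow> card B2 = \<Delta> \<Longrightarrow> card B3 = \<Delta> \<Longrightarrow> 1 \<le> \<Delta> \<Longrightarrow>
      real (card {(x, y). x \<in> B1 \<and> y \<in> B2 \<and> \<alpha> * x + \<beta> * y \<in> B3})
        \<le> 24 * K powr (8/15) * real (card A) powr (1/3) * real \<Delta> powr (4/3)"
  shows "real (card A) powr (19/6) * K powr (- (8/5))
    \<le> 655360 * (real (floor_log (card A) + 1))\<^sup>2 * (real (card (A + A)))\<^sup>2"
proof -
  define x where "x = real (card A)"
  define \<sigma> where "\<sigma> = real (card (A + A))"
  define q where "q = real (floor_log (card A) + 1)"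
  have q1: "1 \<le> q" by (simp add: q_def)
  have x1: "1 \<le> x" using A by (simp add: x_def Suc_le_eq card_gt_0_iff)
  have \<sigma>x: "x \<le> \<sigma>" unfolding x_def \<sigma>_def using card_le_sumset[OF A(1)] by simp
  have finF: "finite (F l)" and FA: "card (F l) \<le> card A" if "l \<in> \<Lambda>" for l
  proof -
    have "F l \<subseteq> A" using F that by auto
    then show "finite (F l)" "card (F l) \<le> card A" using A(1) by (auto intro: finite_subset card_mono)
  qed
  \<comment> \<open>At most \<open>K * x\<close> slopes lie below this threshold, so they carry at
    most \<open>x^2 / 8\<close>, half of the guaranteed mass. The threshold later gives
    \<open>D \<ge> x / (16 * K)\<close>.\<close>
  define P where "P = {l \<in> \<Lambda>. x / (8 * K) \<le> real (card (F l))}"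
  have finP: "finite P" using L by (simp add: P_def)
  have "(\<Sum>l\<in>\<Lambda>. real (card (F l))) = (\<Sum>l\<in>P. real (card (F l))) + (\<Sum>l\<in>\<Lambda> - P. real (card (F l)))"
    using L by (subst sum.subset_diff[of P]) (auto simp: P_def)
  also have "(\<Sum>l\<in>\<Lambda> - P. real (card (F l))) \<le> (\<Sum>l\<in>\<Lambda> - P. x / (8 * K))"
    by (intro sum_mono) (auto simp: P_def)
  also have "\<dots> = real (card (\<Lambda> - P)) * (x / (8 * K))" by simp
  also have "\<dots> \<le> (K * x) * (x / (8 * K))"
  proof (rule mult_right_mono)
    have "card (\<Lambda> - P) \<le> card \<Lambda>" using L by (intro card_mono) auto
    then show "real (card (\<Lambda> - P)) \<le> K * x" using L(2) unfolding x_def by linarith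
  qed (use x1 K in auto)
  also have "\<dots> = x\<^sup>2 / 8" using K by (simp add: power2_eq_square)
  finally have massP: "x\<^sup>2 / 8 \<le> (\<Sum>l\<in>P. real (card (F l)))" using mass unfolding x_def by linarith
  have P1: "1 \<le> card (F l)" "card (F l) \<le> card A" if "l \<in> P" for l
  proof -
    have "0 < x / (8 * K)" using x1 K by simp
    then have "0 < real (card (F l))" using that unfolding P_def by simp
    then show "1 \<le> card (F l)" by simp
    show "card (F l) \<le> card A" using that FA by (simp add: P_def)
  qed
  obtain j where "(\<Sum>l\<in>P. card (F l))
      \<le> (floor_log (card A) + 1) * (card {l \<in> P. floor_log (card (F l)) = j} * 2 ^ (j + 1))"
    by (rule ex_dyadic_level[OF finP, of "\<lambda>l. card (F l)" "card A"]) (use P1 in auto)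
  then have j: "real (\<Sum>l\<in>P. card (F l))
      \<le> real ((floor_log (card A) + 1) * (card {l \<in> P. floor_log (card (F l)) = j} * 2 ^ (j + 1)))"
    by (rule of_nat_mono)
  define R where "R = {l \<in> P. floor_log (card (F l)) = j}"
  define \<Delta> :: nat where "\<Delta> = 2 ^ j"
  define n where "n = real (card R)"
  define D where "D = real \<Delta>"
  have RL: "R \<subseteq> \<Lambda>" by (auto simp: R_def P_def)
  have finR: "finite R" using finP by (simp add: R_def)
  have "x\<^sup>2 / 8 \<le> q * (n * (2 * D))"
    using massP j unfolding q_def n_def D_def \<Delta>_def R_def
    by (simp only: of_nat_mult of_nat_sum of_nat_power power_add of_nat_numeral power_one_right mult_ac)
  then have main: "x\<^sup>2 \<le> 16 * q * n * D" by simp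
  have D1: "1 \<le> \<Delta>" by (simp add: \<Delta>_def)
  have D0: "1 \<le> D" using D1 by (simp add: D_def)
  have "R \<noteq> {}"
  proof
    assume "R = {}"
    then have "x\<^sup>2 \<le> 0" using main by (simp add: n_def)
    then show False using x1 by simp
  qed
  then obtain l0 where l0: "l0 \<in> R" by auto
  have Dle: "\<Delta> \<le> card (F l)" and Dge: "card (F l) \<le> 2 * \<Delta>" if "l \<in> R" for l
    using floor_log_exp2_le[of "card (F l)"] floor_log_exp2_ge[of "card (F l)"] P1(1)[of l] that
    by (auto simp: R_def \<Delta>_def)
  have Dx: "D \<le> x" using Dle[OF l0] P1(2)[of l0] l0 by (simp add: D_def x_def R_def)
  have "x / (8 * K) \<le> 2 * D"
    using Dge[OF l0] l0 by (auto simp: R_def P_def D_def)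
  then have xD: "x \<le> 16 * K * D" using K by (simp add: pos_divide_le_eq mult_ac)
  \<comment> \<open>On the chosen dyadic level, trimming to exactly \<open>\<Delta> = 2 ^ j\<close>
    points loses at most a factor 2 per slope.\<close>
  have "\<forall>l\<in>R. \<exists>B. B \<subseteq> F l \<and> card B = \<Delta>" by (metis Dle obtain_subset_with_card_n)
  then obtain G where G: "\<And>l. l \<in> R \<Longrightarrow> G l \<subseteq> F l \<and> card (G l) = \<Delta>" by metis
  define T0 where "T0 = 24 * K powr (8/15) * x powr (1/3) * D powr (4/3)"
  have T0: "0 < T0" using x1 K D0 by (simp add: T0_def)
  note bd = cluster_size_bounds[OF x1 K _ Dx xD, folded T0_def]
  \<comment> \<open>The real cluster size allowed by the overlap condition. If it is below 2, then
    \<open>M = 2\<close> is taken, where a cluster has no overlaps.\<close>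
  define s where "s = D / sqrt T0"
  have s0: "0 < s" using D0 T0 by (simp add: s_def)
  define M where "M = max 2 (nat \<lfloor>s\<rfloor>)"
  have M2: "2 \<le> M" by (simp add: M_def)
  have Ms: "s \<le> 2 * real M" unfolding M_def using s0 by linarith
  have M_le: "M = 2 \<or> real M \<le> s" unfolding M_def using s0 by linarith
  show ?thesis
  proof (cases "M \<le> card R")
    case True
    have "n * real M * D\<^sup>2 \<le> 16 * \<sigma>\<^sup>2"
      unfolding n_def D_def \<sigma>_def
    proof (rule sumset_card_ge_clusters[OF A(1,3) finR M2 True, where F = G and T = T0])
      fix l1 l2 l3 \<alpha> \<beta> :: real
      assume "l1 \<in> R" "l2 \<in> R" "l3 \<in> R" "\<alpha> \<noteq> 0" "\<beta> \<noteq> 0"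
      then show "real (card {(x, y). x \<in> G l1 \<and> y \<in> G l2 \<and> \<alpha> * x + \<beta> * y \<in> G l3}) \<le> T0"
        unfolding T0_def x_def D_def using RL G D1 by (intro T[of l1 l2 l3]) auto
    next
      show "M = 2 \<or> (real M)\<^sup>2 * T0 \<le> (real \<Delta>)\<^sup>2"
        using M_le
      proof
        assume "real M \<le> s"
        then have "(real M)\<^sup>2 \<le> s\<^sup>2" by (intro power_mono) auto
        also have "s\<^sup>2 = D\<^sup>2 / T0" using T0 by (simp add: s_def power_divide)
        finally show ?thesis using T0 by (simp add: D_def pos_le_divide_eq)
      qed simp
    qed (use G RL F in blast)+
    moreover have "n * (s / 2) * D\<^sup>2 \<le> n * real M * D\<^sup>2"
      using Ms by (intro mult_right_mono mult_left_mono) (auto simp: n_def)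
    ultimately have c: "n * s * D\<^sup>2 \<le> 32 * \<sigma>\<^sup>2" by simp
    have "x powr (19/6) * K powr (- (8/5)) = x\<^sup>2 * (x powr (7/6) * K powr (- (8/5)))"
      using x1 by (simp flip: powr_add powr_numeral mult.assoc)
    also have "\<dots> \<le> (16 * q * n * D) * (1280 * (D\<^sup>2 / sqrt T0))"
      using main bd(1) D0 q1 x1 by (intro mult_mono[OF main]) (auto simp: n_def)
    also have "\<dots> = 20480 * q * (n * s * D\<^sup>2)" by (simp add: s_def power2_eq_square)
    also have "\<dots> \<le> 20480 * q * (32 * \<sigma>\<^sup>2)" using c q1 by (intro mult_left_mono) auto
    also have "\<dots> = 655360 * (q * 1) * \<sigma>\<^sup>2" by simp
    also have "\<dots> \<le> 655360 * (q * q) * \<sigma>\<^sup>2" using q1 by (intro mult_right_mono mult_left_mono) auto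
    finally show ?thesis by (simp add: x_def q_def \<sigma>_def power2_eq_square)
  next
    \<comment> \<open>With too few slopes for one cluster, \<open>n\<close> is at most
      \<open>2 * x powr (1/6)\<close>. The mass bound then forces \<open>x powr (7/6)\<close> below
      a multiple of \<open>q^2\<close>, and the trivial estimate \<open>x \<le> \<sigma>\<close>
      suffices.\<close>
    case False
    have "1 \<le> x powr (1/6)" using x1 by (simp add: ge_one_powr_ge_zero)
    then have "real M \<le> 2 * x powr (1/6)" using M_le bd(2) D0 s0 unfolding s_def by auto
    then have n: "n \<le> 2 * x powr (1/6)" using False by (simp add: n_def)
    have "x * x \<le> (16 * q * n) * D" using main by (simp add: power2_eq_square)
    also have "\<dots> \<le> (16 * q * n) * x" using Dx q1 by (intro mult_left_mono) (auto simp: n_def)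
    finally have "x \<le> 16 * q * n" using x1 by simp
    also have "\<dots> \<le> 16 * q * (2 * x powr (1/6))" using n q1 by (intro mult_left_mono) auto
    finally have "x powr (5/6) * x powr (1/6) \<le> 32 * q * x powr (1/6)"
      using x1 by (simp flip: powr_add)
    then have "x powr (5/6) \<le> 32 * q" using x1 by simp
    then have "(x powr (5/6)) powr (7/5) \<le> (32 * q) powr (7/5)" by (intro powr_mono2) auto
    also have "\<dots> \<le> (32 * q) powr 2" using q1 by (intro powr_mono) auto
    finally have x7: "x powr (7/6) \<le> 1024 * q\<^sup>2" using q1 by (simp add: powr_powr power_mult_distrib)
    have "x powr (19/6) * K powr (- (8/5)) \<le> x powr (19/6) * 1"
      using K by (intro mult_left_mono) (auto simp: powr_minus inverse_le_1_iff ge_one_powr_ge_zero)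
    also have "\<dots> = x\<^sup>2 * x powr (7/6)" using x1 by (simp flip: powr_add powr_numeral)
    also have "\<dots> \<le> \<sigma>\<^sup>2 * (1024 * q\<^sup>2)" using x7 \<sigma>x x1 by (intro mult_mono power_mono) auto
    also have "\<dots> \<le> 655360 * q\<^sup>2 * \<sigma>\<^sup>2" by simp
    finally show ?thesis by (simp add: x_def q_def \<sigma>_def)
  qed
qed

section \<open>Sets with few ratios\<close>

lemma finite_ratio_set: "finite A \<Longrightarrow> finite (ratio_set A)"
  unfolding ratio_set_def
  by (rule finite_subset[of _ "(\<lambda>(a, b). a / b) ` (A \<times> A)"]) auto

lemma ratio_set_mono: "A \<subseteq> B \<Longrightarrow> ratio_set A \<subseteq> ratio_set B"
  by (auto simp: ratio_set_def)

lemma sum_card_dilate_Int: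
  fixes A \<Lambda> :: "'a::field set"
  assumes "finite A" "finite \<Lambda>" "0 \<notin> A"
  shows "(\<Sum>l\<in>\<Lambda>. card {x \<in> A. l * x \<in> A}) = card {(a, b). a \<in> A \<and> b \<in> A \<and> a / b \<in> \<Lambda>}"
proof -
  have "(\<Sum>l\<in>\<Lambda>. card {x \<in> A. l * x \<in> A}) = card (Sigma \<Lambda> (\<lambda>l. {x \<in> A. l * x \<in> A}))"
    using assms by (simp add: card_SigmaI)
  also have "\<dots> = card {(a, b). a \<in> A \<and> b \<in> A \<and> a / b \<in> \<Lambda>}"
    by (rule bij_betw_same_card[OF bij_betwI[where f = "\<lambda>(l, x). (l * x, x)" and g = "\<lambda>(a, b). (a / b, b)"]])
      (use assms in auto)
  finally show ?thesis .
qed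

text \<open>Evaluates the bound on solutions for the two kinds of factorisation, with
  \<open>t\<close> the number of solutions and \<open>D\<close> the size of the trimmed sets. A
  threshold exponent \<open>\<tau>\<close> of \<open>K\<close> leaves \<open>2/3 * \<tau>\<close> in
  the first case and \<open>4/3 - \<tau>\<close> in the second; \<open>\<tau> = 4/5\<close> makes
  both 8/15. The linear term is absorbed, giving \<open>24 = 18 + 6\<close>.\<close>

lemma linear_relation_exponents:
  fixes K x D h t :: real
  assumes x: "1 \<le> x" and K: "1 \<le> K" and D: "1 \<le> D"
  shows "0 \<le> h \<Longrightarrow> h \<le> K powr (4/5) * x \<Longrightarrow> x * t \<le> 18 * (h * D * (x * D)) powr (2/3) + 6 * (x * D)
      \<Longrightarrow> t \<le> 24 * K powr (8/15) * x powr (1/3) * D powr (4/3)"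
    and "0 \<le> h \<Longrightarrow> h \<le> K * x \<Longrightarrow> K powr (4/5) * x * t \<le> 18 * (h * D * (h * D)) powr (2/3) + 6 * (h * D)
      \<Longrightarrow> t \<le> 24 * K powr (8/15) * x powr (1/3) * D powr (4/3)"
proof -
  have pos: "0 < x" "0 < K" "0 < D" using assms by auto
  define E where "E = K powr (8/15) * x powr (1/3) * D powr (4/3)"
  have one: "1 \<le> x powr (1/3)" using x by (simp add: ge_one_powr_ge_zero)
  have D': "D \<le> D powr (4/3)" using powr_mono[of 1 "4/3" D] D by simp
  have K1: "K powr (1/5) \<le> K powr (8/15)" "1 \<le> K powr (1/5)"
    using K by (auto intro: powr_mono ge_one_powr_ge_zero)
  have KDE: "K powr (1/5) * D \<le> E"
  proof -
    have "K powr (1/5) * 1 * D \<le> K powr (8/15) * x powr (1/3) * D powr (4/3)"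
      using K1 one D' D by (intro mult_mono) auto
    then show ?thesis by (simp add: E_def)
  qed
  have DE: "D \<le> E"
  proof -
    have "1 * D \<le> K powr (1/5) * D" using K1 D by (intro mult_right_mono) auto
    then show ?thesis using KDE by simp
  qed
  have x43: "x powr (4/3) = x * x powr (1/3)" using powr_add[of x 1 "1/3"] x by simp
  {
    assume h: "0 \<le> h" "h \<le> K powr (4/5) * x" and t: "x * t \<le> 18 * (h * D * (x * D)) powr (2/3) + 6 * (x * D)"
    have "(h * D * (x * D)) powr (2/3) \<le> ((K powr (4/5) * x) * D * (x * D)) powr (2/3)"
      using h pos by (intro powr_mono2 mult_right_mono mult_nonneg_nonneg) auto
    also have "(K powr (4/5) * x) * D * (x * D) = K powr (4/5) * (x powr 2 * D powr 2)"
      using pos by (simp add: power2_eq_square)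
    also have "\<dots> powr (2/3) = K powr (8/15) * (x powr (4/3) * D powr (4/3))"
      using pos by (simp add: powr_mult powr_powr del: powr_numeral)
    also have "\<dots> = x * E" by (simp add: x43 E_def mult_ac)
    finally have "x * t \<le> 18 * (x * E) + 6 * (x * E)" using t DE pos mult_left_mono[OF DE, of x] by linarith
    then have "x * t \<le> x * (24 * E)" by (simp add: mult_ac)
    then show "t \<le> 24 * K powr (8/15) * x powr (1/3) * D powr (4/3)" using pos by (simp add: E_def mult_ac)
  }
  {
    assume h: "0 \<le> h" "h \<le> K * x"
      and t: "K powr (4/5) * x * t \<le> 18 * (h * D * (h * D)) powr (2/3) + 6 * (h * D)"
    define l where "l = K powr (4/5) * x"
    have l: "0 < l" using pos by (simp add: l_def)
    have K45: "K = K powr (4/5) * K powr (1/5)" using pos by (simp flip: powr_add)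
    have K43: "K powr (4/3) = K powr (4/5) * K powr (8/15)" by (simp flip: powr_add)
    have "(h * D * (h * D)) powr (2/3) \<le> ((K * x) * D * ((K * x) * D)) powr (2/3)"
      using h pos by (intro powr_mono2 mult_mono mult_nonneg_nonneg) auto
    also have "(K * x) * D * ((K * x) * D) = K powr 2 * (x powr 2 * D powr 2)"
      using pos by (simp add: power2_eq_square)
    also have "\<dots> powr (2/3) = K powr (4/3) * (x powr (4/3) * D powr (4/3))"
      using pos by (simp add: powr_mult powr_powr del: powr_numeral)
    also have "\<dots> = l * E" by (simp add: x43 K43 E_def l_def mult_ac)
    finally have 1: "(h * D * (h * D)) powr (2/3) \<le> l * E" .
    have "h * D \<le> K * x * D" using h pos by (intro mult_right_mono) auto
    also have "\<dots> = l * (K powr (1/5) * D)" unfolding l_def by (subst K45) (simp add: mult_ac)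
    also have "\<dots> \<le> l * E" using l KDE by (intro mult_left_mono) auto
    finally have "l * t \<le> 18 * (l * E) + 6 * (l * E)" using t 1 unfolding l_def by linarith
    then have "l * t \<le> l * (24 * E)" by (simp add: mult_ac)
    then show "t \<le> 24 * K powr (8/15) * x powr (1/3) * D powr (4/3)" using l by (simp add: E_def mult_ac)
  }
qed

theorem sumset_bound_of_small_ratio_set_pos:
  fixes A :: "real set" and K :: real
  assumes A: "finite A" "A \<noteq> {}" "\<And>a. a \<in> A \<Longrightarrow> 0 < a" and K: "1 \<le> K"
    and ratio: "real (card (ratio_set A)) \<le> K * real (card A)"
  shows "real (card A) powr (19/6) * K powr (- (8/5))
    \<le> 655360 * (real (floor_log (card A) + 1))\<^sup>2 * (real (card (A + A)))\<^sup>2"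
proof -
  define x where "x = real (card A)"
  have x1: "1 \<le> x" using A by (simp add: x_def Suc_le_eq card_gt_0_iff)
  define Q where "Q = ratio_set A"
  have finQ: "finite Q" using A by (simp add: Q_def finite_ratio_set)
  have Q0: "0 < r" if "r \<in> Q" for r using that A(3) by (auto simp: Q_def ratio_set_def)
  have QI: "a / b \<in> Q" if "a \<in> A" "b \<in> A" for a b
    using that A(3)[of b] by (auto simp: Q_def ratio_set_def)
  have A0: "0 \<notin> A" using A(3) by auto
  \<comment> \<open>This is \<open>Q \<inter> Q/l\<close>. Its size controls the supply of factors
    in one case and the number of factorisations in the other.\<close>
  define H where "H l = {r \<in> Q. l * r \<in> Q}" for l
  have finH: "finite (H l)" for l using finQ by (simp add: H_def)
  define t where "t = K powr (4/5) * x"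
  define big where "big b = {a \<in> A. t < real (card (H (a / b)))}" for b
  have finbig: "finite (big b)" for b using A by (simp add: big_def)
  show ?thesis
  proof (cases "\<exists>b\<in>A. x / 2 \<le> real (card (big b))")
    case True
    then obtain b where b: "b \<in> A" "x / 2 \<le> real (card (big b))" by auto
    \<comment> \<open>Passing to at least half of \<open>A\<close> keeps
      \<open>(card A')^2 \<ge> x^2 / 4\<close> pairs, just the mass that is required of the
      slopes.\<close>
    define A' where "A' = big b"
    have A': "finite A'" "A' \<subseteq> A" "0 \<notin> A'" using finbig A0 by (auto simp: A'_def big_def)
    define F where "F l = {y \<in> A'. l * y \<in> A'}" for l
    have rs: "ratio_set A' \<subseteq> Q" unfolding Q_def by (rule ratio_set_mono) (use A' in auto)
    show ?thesis
    proof (rule sumset_bound_of_rich_slopes[OF A K, of "ratio_set A'" F])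
      show "finite (ratio_set A')" using A' by (simp add: finite_ratio_set)
      have "card (ratio_set A') \<le> card Q" by (rule card_mono[OF finQ rs])
      then show "real (card (ratio_set A')) \<le> K * real (card A)" using ratio unfolding Q_def by linarith
      show "y \<in> A \<and> l * y \<in> A" if "y \<in> F l" for l y using that A' by (auto simp: F_def)
      have "{(a, b). a \<in> A' \<and> b \<in> A' \<and> a / b \<in> ratio_set A'} = A' \<times> A'"
        using A'(3) by (auto simp: ratio_set_def)
      then have "(\<Sum>l\<in>ratio_set A'. card (F l)) = card A' * card A'"
        unfolding F_def using A' by (subst sum_card_dilate_Int) (auto simp: finite_ratio_set card_cartesian_product)
      then have "(\<Sum>l\<in>ratio_set A'. real (card (F l))) = (real (card A'))\<^sup>2"
        by (simp add: power2_eq_square flip: of_nat_sum of_nat_mult)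
      moreover have "(x / 2)\<^sup>2 \<le> (real (card A'))\<^sup>2" using b x1 unfolding A'_def by (intro power_mono) auto
      ultimately show "(real (card A))\<^sup>2 / 4 \<le> (\<Sum>l\<in>ratio_set A'. real (card (F l)))"
        by (simp add: x_def power_divide)
    next
      fix l1 l2 l3 \<alpha> \<beta> :: real and B1 B2 B3 :: "real set" and \<Delta> :: nat
      assume nz: "\<alpha> \<noteq> 0" "\<beta> \<noteq> 0" and sub: "B1 \<subseteq> F l1" "B2 \<subseteq> F l2" "B3 \<subseteq> F l3"
        and c: "card B1 = \<Delta>" "card B2 = \<Delta>" "card B3 = \<Delta>" and D1: "1 \<le> \<Delta>"
      have fB: "finite B1" "finite B2" "finite B3" using c D1 by (auto intro: card_ge_0_finite)
      have B1: "y \<in> A'" if "y \<in> B1" for y using sub that by (auto simp: F_def)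
      \<comment> \<open>For \<open>y\<close> in \<open>A'\<close> every \<open>r\<close> in
        \<open>H (y / b)\<close> gives a factorisation of \<open>y\<close> into
        \<open>b * (y / b * r)\<close> and \<open>inverse r\<close>, hence more than
        \<open>t\<close> of them.\<close>
      let ?U = "(\<lambda>r. b * r) ` Q" and ?V = "inverse ` Q"
      have cU: "card ?U = card Q" using A(3)[OF b(1)] by (intro card_image) (auto simp: inj_on_def)
      have cV: "card ?V = card Q" by (intro card_image) (auto simp: inj_on_def)
      have "t * real (card {(y, z). y \<in> B1 \<and> z \<in> B2 \<and> \<alpha> * y + \<beta> * z \<in> B3})
        \<le> 18 * (real (card ?U) * real (card B3) * (real (card ?V) * real (card B2))) powr (2/3)
          + 6 * (real (card ?V) * real (card B2))"
      proof (rule card_linear_relation_bound[OF fB _ _ _ nz])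
        show "0 \<notin> ?V" using Q0 by force
        fix y assume y: "y \<in> B1"
        let ?R = "{(u, v). u \<in> ?U \<and> v \<in> ?V \<and> u * v = y}"
        have b0: "0 < b" using A b by auto
        have "card (H (y / b)) \<le> card ?R"
        proof (rule card_inj_on_le[where f = "\<lambda>r. (b * (y / b * r), inverse r)"])
          show "inj_on (\<lambda>r. (b * (y / b * r), inverse r)) (H (y / b))" by (auto simp: inj_on_def)
          show "finite ?R" by (rule finite_subset[of _ "?U \<times> ?V"]) (use finQ in auto)
          show "(\<lambda>r. (b * (y / b * r), inverse r)) ` H (y / b) \<subseteq> ?R"
          proof (rule image_subsetI)
            fix r assume r: "r \<in> H (y / b)"
            then have "r \<in> Q" "y / b * r \<in> Q" by (auto simp: H_def)
            moreover have "b * (y / b * r) * inverse r = y" using b0 Q0[OF \<open>r \<in> Q\<close>] by simp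
            ultimately show "(b * (y / b * r), inverse r) \<in> ?R" by blast
          qed
        qed
        moreover have "t < real (card (H (y / b)))" using B1[OF y] by (simp add: A'_def big_def)
        ultimately show "t \<le> real (card ?R)" by linarith
      qed (use finQ in auto)
      then show "real (card {(y, z). y \<in> B1 \<and> z \<in> B2 \<and> \<alpha> * y + \<beta> * z \<in> B3})
        \<le> 24 * K powr (8/15) * real (card A) powr (1/3) * real \<Delta> powr (4/3)"
        unfolding cU cV c t_def x_def[symmetric]
        by (intro linear_relation_exponents(2)[of _ _ _ "real (card Q)"])
          (use x1 K D1 ratio in \<open>auto simp: Q_def x_def\<close>)
    qed
  next
    case False
    define \<Lambda> where "\<Lambda> = {l \<in> Q. real (card (H l)) \<le> t}"
    define F where "F l = {y \<in> A. l * y \<in> A}" for l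
    show ?thesis
    proof (rule sumset_bound_of_rich_slopes[OF A K, of \<Lambda> F])
      show "finite \<Lambda>" using finQ by (simp add: \<Lambda>_def)
      have "card \<Lambda> \<le> card Q" by (rule card_mono[OF finQ]) (auto simp: \<Lambda>_def)
      then show "real (card \<Lambda>) \<le> K * real (card A)" using ratio unfolding Q_def by linarith
      show "y \<in> A \<and> l * y \<in> A" if "y \<in> F l" for l y using that by (auto simp: F_def)
      let ?S = "{(a, b). a \<in> A \<and> b \<in> A \<and> a / b \<in> \<Lambda>}"
      have finS: "finite ?S" by (rule finite_subset[of _ "A \<times> A"]) (use A in auto)
      \<comment> \<open>For every \<open>b\<close>, more than half of the \<open>a\<close> in
        \<open>A\<close> have \<open>a / b\<close> in \<open>\<Lambda>\<close>, so the slopes in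
        \<open>\<Lambda>\<close> carry at least \<open>x^2 / 2\<close> pairs.\<close>
      have "x / 2 * x = (\<Sum>b\<in>A. x / 2)" by (simp add: x_def)
      also have "\<dots> \<le> (\<Sum>b\<in>A. real (card (A - big b)))"
      proof (rule sum_mono)
        fix b assume "b \<in> A"
        then have "real (card (big b)) < x / 2" using False by force
        moreover have "card (A - big b) + card (big b) = card A"
          using A(1) by (subst card_Un_disjoint[symmetric]) (auto simp: big_def intro: arg_cong[where f = card])
        ultimately show "x / 2 \<le> real (card (A - big b))" unfolding x_def by linarith
      qed
      also have "\<dots> = real (card (Sigma A (\<lambda>b. A - big b)))" using A by (simp add: card_SigmaI)
      also have "card (Sigma A (\<lambda>b. A - big b)) \<le> card ?S"
        by (rule card_inj_on_le[where f = prod.swap]) (use finS QI in \<open>auto simp: big_def \<Lambda>_def inj_on_def\<close>)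
      also have "card ?S = (\<Sum>l\<in>\<Lambda>. card (F l))"
        unfolding F_def using A A0 finQ by (intro sum_card_dilate_Int[symmetric]) (auto simp: \<Lambda>_def)
      finally have "x\<^sup>2 / 2 \<le> (\<Sum>l\<in>\<Lambda>. real (card (F l)))" by (simp add: power2_eq_square)
      then show "(real (card A))\<^sup>2 / 4 \<le> (\<Sum>l\<in>\<Lambda>. real (card (F l)))"
        using zero_le_power2[of x] unfolding x_def by linarith
    next
      fix l1 l2 l3 \<alpha> \<beta> :: real and B1 B2 B3 :: "real set" and \<Delta> :: nat
      assume l1: "l1 \<in> \<Lambda>" and nz: "\<alpha> \<noteq> 0" "\<beta> \<noteq> 0" and sub: "B1 \<subseteq> F l1" "B2 \<subseteq> F l2" "B3 \<subseteq> F l3"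
        and c: "card B1 = \<Delta>" "card B2 = \<Delta>" "card B3 = \<Delta>" and D1: "1 \<le> \<Delta>"
      have fB: "finite B1" "finite B2" "finite B3" using c D1 by (auto intro: card_ge_0_finite)
      \<comment> \<open>Each \<open>a\<close> in \<open>A\<close> gives the factorisation
        \<open>y = (y / a) * a\<close>. Both \<open>y\<close> and \<open>l1 * y\<close> lie in
        \<open>A\<close>, so \<open>y / a\<close> lies in \<open>H l1\<close>, a set of at most
        \<open>t\<close> elements.\<close>
      have "x * real (card {(y, z). y \<in> B1 \<and> z \<in> B2 \<and> \<alpha> * y + \<beta> * z \<in> B3})
        \<le> 18 * (real (card (H l1)) * real (card B3) * (real (card A) * real (card B2))) powr (2/3)
          + 6 * (real (card A) * real (card B2))"
      proof (rule card_linear_relation_bound[OF fB finH A(1) A0 nz])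
        fix y assume "y \<in> B1"
        then have y: "y \<in> A" "l1 * y \<in> A" using sub by (auto simp: F_def)
        let ?R = "{(u, v). u \<in> H l1 \<and> v \<in> A \<and> u * v = y}"
        have "card A \<le> card ?R"
        proof (rule card_inj_on_le[where f = "\<lambda>a. (y / a, a)"])
          show "finite ?R" by (rule finite_subset[of _ "H l1 \<times> A"]) (use finH A in auto)
          show "(\<lambda>a. (y / a, a)) ` A \<subseteq> ?R"
          proof (rule image_subsetI)
            fix a assume a: "a \<in> A"
            then show "(y / a, a) \<in> ?R" using QI[OF y(1) a] QI[OF y(2) a] A(3)[OF a] by (simp add: H_def)
          qed
        qed (auto simp: inj_on_def)
        then show "x \<le> real (card ?R)" by (simp add: x_def)
      qed
      then show "real (card {(y, z). y \<in> B1 \<and> z \<in> B2 \<and> \<alpha> * y + \<beta> * z \<in> B3})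
        \<le> 24 * K powr (8/15) * real (card A) powr (1/3) * real \<Delta> powr (4/3)"
        unfolding c x_def[symmetric]
        by (intro linear_relation_exponents(1)[of _ _ _ "real (card (H l1))"])
          (use x1 K D1 l1 in \<open>auto simp: \<Lambda>_def t_def\<close>)
    qed
  qed
qed

section \<open>Reduction to positive sets and the final constants\<close>

lemma ex_large_positive_part:
  fixes A :: "real set"
  assumes A: "finite A" "2 \<le> card A"
  obtains B :: "real set" where "finite B" "\<forall>b\<in>B. 0 < b" "card A \<le> 4 * card B" "card B \<le> card A"
    "card (ratio_set B) \<le> card (ratio_set A)" "card (B + B) \<le> card (A + A)"
proof -
  define P N where "P = {a \<in> A. 0 < a}" and "N = {a \<in> A. a < 0}"
  have fin: "finite P" "finite N" using A by (auto simp: P_def N_def)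
  have "A \<subseteq> {0} \<union> P \<union> N" by (auto simp: P_def N_def)
  then have "card A \<le> card ({0} \<union> P \<union> N)" using fin by (intro card_mono) auto
  also have "\<dots> \<le> card {0::real} + card P + card N"
    by (meson add_mono card_Un_le le_trans order_refl)
  \<comment> \<open>The larger sign class has at least \<open>(card A - 1) / 2\<close> elements,
    which is at least \<open>card A / 4\<close> because \<open>card A \<ge> 2\<close>.\<close>
  finally have "card A \<le> 4 * card P \<or> card A \<le> 4 * card N" using A by simp linarith
  then show ?thesis
  proof
    assume c: "card A \<le> 4 * card P"
    have "P \<subseteq> A" by (auto simp: P_def)
    then show ?thesis
      using c A fin by (intro that[of P] card_mono finite_ratio_set ratio_set_mono finite_set_plus set_plus_mono2)
        (auto simp: P_def)
  next
    assume c: "card A \<le> 4 * card N"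
    have NA: "N \<subseteq> A" by (auto simp: N_def)
    have cN: "card (uminus ` N) = card N" by (intro card_image) auto
    \<comment> \<open>Negating both numerator and denominator leaves a quotient unchanged.\<close>
    have "ratio_set (uminus ` N) \<subseteq> ratio_set A"
      using NA by (auto simp: ratio_set_def) blast
    then have r: "card (ratio_set (uminus ` N)) \<le> card (ratio_set A)"
      using A by (intro card_mono finite_ratio_set)
    have "uminus ` N + uminus ` N \<subseteq> uminus ` (A + A)"
    proof
      fix z assume "z \<in> uminus ` N + uminus ` N"
      then obtain a b where "a \<in> N" "b \<in> N" "z = - a + - b" by (auto elim!: set_plus_elim)
      then show "z \<in> uminus ` (A + A)"
        using NA by (intro image_eqI[of _ _ "a + b"] set_plus_intro) auto
    qed
    then have "card (uminus ` N + uminus ` N) \<le> card (uminus ` (A + A))"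
      using A by (intro card_mono finite_imageI finite_set_plus)
    also have "\<dots> = card (A + A)" by (intro card_image) auto
    finally show ?thesis
      using c r fin cN card_mono[OF A(1) NA] by (intro that[of "uminus ` N"]) (auto simp: N_def)
  qed
qed

theorem sumset_bound_of_small_ratio_set:
  fixes A :: "real set" and K :: real
  assumes A: "finite A" "2 \<le> card A" and K: "1 \<le> K"
    and ratio: "real (card (ratio_set A)) \<le> K * real (card A)"
  shows "real (card A) powr (19/12) * K powr (- (4/5)) \<le> 77760 * (real (card (A + A)) * ln (real (card A)))"
proof -
  obtain B :: "real set" where B: "finite B" "\<forall>b\<in>B. 0 < b" "card A \<le> 4 * card B" "card B \<le> card A"
    "card (ratio_set B) \<le> card (ratio_set A)" "card (B + B) \<le> card (A + A)"
    using ex_large_positive_part[OF A] by blast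
  define x y \<sigma> q where "x = real (card A)" and "y = real (card B)" and "\<sigma> = real (card (A + A))"
    and "q = real (floor_log (card B) + 1)"
  have x2: "2 \<le> x" using A(2) by (simp add: x_def)
  have xy: "x \<le> 4 * y" "y \<le> x" using B(3,4) by (auto simp: x_def y_def)
  have Bne: "B \<noteq> {}" using B(3) A by auto
  \<comment> \<open>The positive part has at least a quarter of the elements, so its ratio bound
    holds with \<open>4 * K\<close> in place of \<open>K\<close>.\<close>
  have "real (card (ratio_set B)) \<le> K * x" using B(5) ratio unfolding x_def by linarith
  also have "\<dots> \<le> 4 * K * y" using xy K mult_left_mono[of x "4 * y" K] by simp
  finally have "y powr (19/6) * (4 * K) powr (- (8/5)) \<le> 655360 * q\<^sup>2 * (real (card (B + B)))\<^sup>2"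
    unfolding y_def q_def using K by (intro sumset_bound_of_small_ratio_set_pos[OF B(1) Bne]) (use B(2) in auto)
  also have "\<dots> \<le> 655360 * q\<^sup>2 * \<sigma>\<^sup>2" using B(6) by (intro mult_left_mono power_mono) (auto simp: \<sigma>_def)
  finally have 1: "y powr (19/6) * (4 * K) powr (- (8/5)) \<le> 655360 * q\<^sup>2 * \<sigma>\<^sup>2" .
  \<comment> \<open>For \<open>x \<ge> 2\<close> the summand 1 is at most \<open>log 2 x\<close>,
    and \<open>ln 2 \<ge> 2/3\<close> turns \<open>2 * log 2 x\<close> into
    \<open>3 * ln x\<close>.\<close>
  have q: "q \<le> 3 * ln x"
  proof -
    have "floor_log (card B) \<le> floor_log (card A)" by (rule floor_log_le_iff[OF B(4)])
    moreover have "real (floor_log (card A)) \<le> log 2 x"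
      using x2 by (simp add: floor_log_altdef x_def)
    ultimately have "q \<le> log 2 x + 1" unfolding q_def by linarith
    moreover have "1 \<le> log 2 x" using x2 by simp
    moreover have "log 2 x \<le> 3 / 2 * ln x"
    proof -
      have "2 / 3 * ln x \<le> ln 2 * ln x" using x2 ln2_ge_two_thirds by (intro mult_right_mono) auto
      then show ?thesis unfolding log_def by (simp add: field_simps)
    qed
    ultimately show ?thesis by linarith
  qed
  have "x powr (19/6) * K powr (- (8/5)) \<le> (4 * y) powr (19/6) * K powr (- (8/5))"
    using xy x2 by (intro mult_right_mono powr_mono2) auto
  also have "\<dots> = (4 powr (19/6) * 4 powr (8/5)) * (y powr (19/6) * (4 * K) powr (- (8/5)))"
    using K xy x2 by (simp add: powr_mult powr_minus field_simps)
  also have "4 powr (19/6) * 4 powr (8/5) = (4 :: real) powr (143/30)" by (simp flip: powr_add)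
  also have "4 powr (143/30) * (y powr (19/6) * (4 * K) powr (- (8/5))) \<le> 4 powr 5 * (655360 * q\<^sup>2 * \<sigma>\<^sup>2)"
    by (intro mult_mono powr_mono 1) auto
  also have "\<dots> = 1024 * (655360 * q\<^sup>2 * \<sigma>\<^sup>2)" by simp
  also have "\<dots> \<le> 1024 * (655360 * (3 * ln x)\<^sup>2 * \<sigma>\<^sup>2)"
    by (intro mult_left_mono mult_right_mono power_mono q) (auto simp: q_def)
  \<comment> \<open>The constant is chosen so that its square exceeds
    \<open>1024 * 655360 * 9\<close>.\<close>
  also have "\<dots> \<le> (77760 * (\<sigma> * ln x))\<^sup>2" by (simp add: power_mult_distrib)
  finally have "sqrt (x powr (19/6) * K powr (- (8/5))) \<le> 77760 * (\<sigma> * ln x)"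
    using x2 by (intro real_le_lsqrt) (auto simp: \<sigma>_def)
  moreover have "sqrt (x powr (19/6) * K powr (- (8/5))) = x powr (19/12) * K powr (- (4/5))"
    using x2 K by (simp add: real_sqrt_mult powr_half_sqrt[symmetric] powr_powr)
  ultimately show ?thesis by (simp add: x_def \<sigma>_def)
qed

theorem theorem5:
  shows "\<exists>C>0. \<exists>M>0. \<forall>(A :: real set) (K :: real).
    finite A \<and> card A \<ge> 2 \<and> K \<ge> 1 \<and> real (card (ratio_set A)) \<le> K * real (card A) \<longrightarrow>
      max (real (card A) powr (19/12) * K powr (- (5/6)))
          (real (card A) powr (1313/830) * K powr (- (336/415)))
        \<le> M * (real (card (A + A)) * ln (real (card A)) powr C)"
proof (rule exI[of _ 1], rule conjI, simp, rule exI[of _ 77760], intro conjI allI impI, simp)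
  fix A :: "real set" and K :: real
  assume *: "finite A \<and> card A \<ge> 2 \<and> K \<ge> 1 \<and> real (card (ratio_set A)) \<le> K * real (card A)"
  then have x: "1 \<le> real (card A)" by simp
  \<comment> \<open>Both terms are dominated since \<open>1313/830 \<le> 19/12\<close>, while 5/6
    and 336/415 are at least 4/5 and both bases are at least 1.\<close>
  have "max (real (card A) powr (19/12) * K powr (- (5/6)))
      (real (card A) powr (1313/830) * K powr (- (336/415)))
    \<le> real (card A) powr (19/12) * K powr (- (4/5))"
    using * x by (intro max.boundedI mult_mono powr_mono) auto
  also have "\<dots> \<le> 77760 * (real (card (A + A)) * ln (real (card A)))"
    using * by (intro sumset_bound_of_small_ratio_set) auto
  finally show "max (real (card A) powr (19/12) * K powr (- (5/6)))
      (real (card A) powr (1313/830) * K powr (- (336/415)))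
    \<le> 77760 * (real (card (A + A)) * ln (real (card A)) powr 1)" using x by simp
qed

end
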